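(* Let $k$ be a commutative ring and $A$ a $k$-algebra. The category $\underline{\mathrm{Desc}}(A/k)$ of descent data and the category $\mathcal{YD}^{A^e}$ of right Yetter-Drinfeld $A^e$-modules are isomorphic.
   Context: Conventions: $\otimes=\otimes_k$; algebras are associative and unital; $A$-bimodules are $k$-central, i.e. modules over $A^e=A\otimes A^{\rm op}$. Descent data. For an $A$-bimodule $V$, regard $A\otimes V$ and $V\otimes A$ as $A\otimes A$-bimodules factorwise, i.e. $(a\otimes b)(x\otimes v)(c\otimes d)=axc\otimes bvd$ and $(a\otimes b)(v\otimes x)(c\otimes d)=avc\otimes bxd$. For an $A\otimes A$-bimodule map $g:A\otimes V\to V\otimes A$, write $g(a\otimes v)=\sum_i v_i\otimes a_i$ and define $g_1:A\otimes A\otimes V\to A\otimes V\otimes A$, $g_1(b\otimes a\otimes v)=\sum_i b\otimes v_i\otimes a_i$; $g_2:A\otimes A\otimes V\to V\otimes A\otimes A$, $g_2(a\otimes b\otimes v)=\sum_i v_i\otimes b\otimes a_i$; $g_3:A\otimes V\otimes A\to V\otimes A\otimes A$, $g_3(a\otimes v\otimes b)=\sum_i v_i\otimes a_i\otimes b$. An object of $\underline{\mathrm{Desc}}(A/k)$ is a pair $(V,g)$, $V$ an $A$-bimodule and $g:A\otimes V\to V\otimes A$ an $A\otimes A$-bimodule map, with $g_2=g_3\circ g_1$ and $\psi(g(1\otimes v))=v$ for all $v\in V$, where $\psi:V\otimes A\to V$, $\psi(v\otimes a)=va$. A morphism $(V,g)\to(V',g')$ is an $A$-bimodule map $f:V\to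 V'$ with $(f\otimes A)\circ g=g'\circ(A\otimes f)$. An object of $\mathcal{YD}^{A^e}$ is a pair $(V,\rho)$ with $V$ an $A$-bimodule and $\rho:V\to V\otimes A$ a $k$-linear map, written $\rho(v)=v_{[0]}\otimes v_{[1]}$ (summation understood), such that for all $v\in V$, $a\in A$: $v_{[0]}v_{[1]}=v$; $\rho(v_{[0]})\otimes v_{[1]}=v_{[0]}\otimes 1\otimes v_{[1]}$ in $V\otimes A\otimes A$; $\rho(va)=v_{[0]}\otimes v_{[1]}a$; $\rho(av)=v_{[0]}\otimes av_{[1]}$; $av_{[0]}\otimes v_{[1]}=v_{[0]}a\otimes v_{[1]}$. Morphisms are $A$-bimodule maps $f$ with $\rho'\circ f=(f\otimes A)\circ\rho$. *)

theory Defs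
  imports "HOL-Algebra.Module" "HOL-Algebra.Free_Abelian_Groups"
begin

section \<open>Algebras and bimodules over a commutative ring\<close>

locale assoc_algebra = module K A + ring A
  for K :: "('k, 'r) ring_scheme" (structure) and A :: "('k, 'a, 's) module_scheme" (structure) +
  assumes smult_mult_left:
      "\<lbrakk>c \<in> carrier K; x \<in> carrier A; y \<in> carrier A\<rbrakk>
        \<Longrightarrow> (c \<odot>\<^bsub>A\<^esub> x) \<otimes>\<^bsub>A\<^esub> y = c \<odot>\<^bsub>A\<^esub> (x \<otimes>\<^bsub>A\<^esub> y)"
    and smult_mult_right:
      "\<lbrakk>c \<in> carrier K; x \<in> carrier A; y \<in> carrier A\<rbrakk>
        \<Longrightarrow> x \<otimes>\<^bsub>A\<^esub> (c \<odot>\<^bsub>A\<^esub> y) = c \<odot>\<^bsub>A\<^esub> (x \<otimes>\<^bsub>A\<^esub> y)"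

record ('k, 'a, 'v) bimod = "('k, 'v) module" +
  lact :: "'a \<Rightarrow> 'v \<Rightarrow> 'v"
  ract :: "'v \<Rightarrow> 'a \<Rightarrow> 'v"

text \<open>The last two axioms say that the two induced actions of the base ring agree with each
  other and with the scalar multiplication; the latter is therefore no additional datum.\<close>

locale bimodule = assoc_algebra K A + V: module K V
  for K :: "('k, 'r) ring_scheme" (structure)
    and A :: "('k, 'a, 's) module_scheme" (structure)
    and V :: "('k, 'a, 'v, 't) bimod_scheme" +
  assumes lact_closed: "\<lbrakk>a \<in> carrier A; v \<in> carrier V\<rbrakk> \<Longrightarrow> lact V a v \<in> carrier V"
    and ract_closed: "\<lbrakk>a \<in> carrier A; v \<in> carrier V\<rbrakk> \<Longrightarrow> ract V v a \<in> carrier V"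
    and lact_add: "\<lbrakk>a \<in> carrier A; v \<in> carrier V; w \<in> carrier V\<rbrakk>
        \<Longrightarrow> lact V a (v \<oplus>\<^bsub>V\<^esub> w) = lact V a v \<oplus>\<^bsub>V\<^esub> lact V a w"
    and ract_add: "\<lbrakk>a \<in> carrier A; v \<in> carrier V; w \<in> carrier V\<rbrakk>
        \<Longrightarrow> ract V (v \<oplus>\<^bsub>V\<^esub> w) a = ract V v a \<oplus>\<^bsub>V\<^esub> ract V w a"
    and add_lact: "\<lbrakk>a \<in> carrier A; b \<in> carrier A; v \<in> carrier V\<rbrakk>
        \<Longrightarrow> lact V (a \<oplus>\<^bsub>A\<^esub> b) v = lact V a v \<oplus>\<^bsub>V\<^esub> lact V b v"
    and add_ract: "\<lbrakk>a \<in> carrier A; b \<in> carrier A; v \<in> carrier V\<rbrakk>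
        \<Longrightarrow> ract V v (a \<oplus>\<^bsub>A\<^esub> b) = ract V v a \<oplus>\<^bsub>V\<^esub> ract V v b"
    and mult_lact: "\<lbrakk>a \<in> carrier A; b \<in> carrier A; v \<in> carrier V\<rbrakk>
        \<Longrightarrow> lact V (a \<otimes>\<^bsub>A\<^esub> b) v = lact V a (lact V b v)"
    and mult_ract: "\<lbrakk>a \<in> carrier A; b \<in> carrier A; v \<in> carrier V\<rbrakk>
        \<Longrightarrow> ract V v (a \<otimes>\<^bsub>A\<^esub> b) = ract V (ract V v a) b"
    and one_lact: "v \<in> carrier V \<Longrightarrow> lact V \<one>\<^bsub>A\<^esub> v = v"
    and one_ract: "v \<in> carrier V \<Longrightarrow> ract V v \<one>\<^bsub>A\<^esub> = v"
    and lact_ract: "\<lbrakk>a \<in> carrier A; b \<in> carrier A; v \<in> carrier V\<rbrakk>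
        \<Longrightarrow> ract V (lact V a v) b = lact V a (ract V v b)"
    and lact_central: "\<lbrakk>c \<in> carrier K; v \<in> carrier V\<rbrakk> \<Longrightarrow> lact V (c \<odot>\<^bsub>A\<^esub> \<one>\<^bsub>A\<^esub>) v = c \<odot>\<^bsub>V\<^esub> v"
    and ract_central: "\<lbrakk>c \<in> carrier K; v \<in> carrier V\<rbrakk> \<Longrightarrow> ract V v (c \<odot>\<^bsub>A\<^esub> \<one>\<^bsub>A\<^esub>) = c \<odot>\<^bsub>V\<^esub> v"

text \<open>Records are total functions, so a bimodule has many representations that differ only
  outside its carrier, and in the ring multiplication and unit inherited from \<^typ>\<open>('k, 'v) module\<close>.
  Fixing these junk values makes equality of records coincide with equality of bimodules,
  which matters because an isomorphism of categories is about equality of objects.\<close>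

definition normalized :: "('k, 'r) ring_scheme \<Rightarrow> ('a, 's) ring_scheme \<Rightarrow> ('k, 'a, 'v) bimod \<Rightarrow> bool"
  where "normalized K A V \<longleftrightarrow>
    (\<lambda>(v, w). v \<oplus>\<^bsub>V\<^esub> w) \<in> extensional (carrier V \<times> carrier V) \<and>
    (\<lambda>(c, v). c \<odot>\<^bsub>V\<^esub> v) \<in> extensional (carrier K \<times> carrier V) \<and>
    (\<lambda>(a, v). lact V a v) \<in> extensional (carrier A \<times> carrier V) \<and>
    (\<lambda>(v, a). ract V v a) \<in> extensional (carrier V \<times> carrier A) \<and>
    monoid.mult V = undefined \<and> \<one>\<^bsub>V\<^esub> = undefined"

definition linear_maps :: "('k, 'r) ring_scheme \<Rightarrow> ('k, 'm, 's) module_scheme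
    \<Rightarrow> ('k, 'n, 't) module_scheme \<Rightarrow> ('m \<Rightarrow> 'n) set"
  where "linear_maps K M N = {f \<in> carrier M \<rightarrow>\<^sub>E carrier N.
    (\<forall>x\<in>carrier M. \<forall>y\<in>carrier M. f (x \<oplus>\<^bsub>M\<^esub> y) = f x \<oplus>\<^bsub>N\<^esub> f y) \<and>
    (\<forall>c\<in>carrier K. \<forall>x\<in>carrier M. f (c \<odot>\<^bsub>M\<^esub> x) = c \<odot>\<^bsub>N\<^esub> f x)}"

definition bimodule_maps :: "('a, 'r) ring_scheme \<Rightarrow> ('k, 'a, 'v, 's) bimod_scheme
    \<Rightarrow> ('k, 'a, 'w, 't) bimod_scheme \<Rightarrow> ('v \<Rightarrow> 'w) set"
  where "bimodule_maps A V W = {f \<in> carrier V \<rightarrow>\<^sub>E carrier W.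
    (\<forall>x\<in>carrier V. \<forall>y\<in>carrier V. f (x \<oplus>\<^bsub>V\<^esub> y) = f x \<oplus>\<^bsub>W\<^esub> f y) \<and>
    (\<forall>a\<in>carrier A. \<forall>x\<in>carrier V. f (lact V a x) = lact W a (f x)) \<and>
    (\<forall>a\<in>carrier A. \<forall>x\<in>carrier V. f (ract V x a) = ract W (f x) a)}"

definition regular_bimodule :: "('k, 'a, 's) module_scheme \<Rightarrow> ('k, 'a, 'a) bimod"
  where "regular_bimodule A =
    \<lparr>carrier = carrier A, monoid.mult = undefined, monoid.one = undefined,
     ring.zero = \<zero>\<^bsub>A\<^esub>, ring.add = add A, smult = smult A,
     lact = monoid.mult A, ract = monoid.mult A\<rparr>"


section \<open>Tensor products over a commutative ring\<close>

type_synonym ('m, 'n) tensor = "('m \<times> 'n \<Rightarrow>\<^sub>0 int) set"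

definition tensor_relators :: "('k, 'r) ring_scheme \<Rightarrow> ('k, 'm, 's) module_scheme
    \<Rightarrow> ('k, 'n, 't) module_scheme \<Rightarrow> ('m \<times> 'n \<Rightarrow>\<^sub>0 int) set"
  where "tensor_relators K M N =
    {frag_of (x \<oplus>\<^bsub>M\<^esub> x', y) - frag_of (x, y) - frag_of (x', y) | x x' y.
        x \<in> carrier M \<and> x' \<in> carrier M \<and> y \<in> carrier N} \<union>
    {frag_of (x, y \<oplus>\<^bsub>N\<^esub> y') - frag_of (x, y) - frag_of (x, y') | x y y'.
        x \<in> carrier M \<and> y \<in> carrier N \<and> y' \<in> carrier N} \<union>
    {frag_of (c \<odot>\<^bsub>M\<^esub> x, y) - frag_of (x, c \<odot>\<^bsub>N\<^esub> y) | c x y.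
        c \<in> carrier K \<and> x \<in> carrier M \<and> y \<in> carrier N}"

definition tensor_subgroup :: "('k, 'r) ring_scheme \<Rightarrow> ('k, 'm, 's) module_scheme
    \<Rightarrow> ('k, 'n, 't) module_scheme \<Rightarrow> ('m \<times> 'n \<Rightarrow>\<^sub>0 int) set"
  where "tensor_subgroup K M N =
    generate (free_Abelian_group (carrier M \<times> carrier N)) (tensor_relators K M N)"

definition tensor_group :: "('k, 'r) ring_scheme \<Rightarrow> ('k, 'm, 's) module_scheme
    \<Rightarrow> ('k, 'n, 't) module_scheme \<Rightarrow> ('m, 'n) tensor monoid"
  where "tensor_group K M N =
    free_Abelian_group (carrier M \<times> carrier N) Mod tensor_subgroup K M N"

definition pure_tensor :: "('k, 'r) ring_scheme \<Rightarrow> ('k, 'm, 's) module_scheme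
    \<Rightarrow> ('k, 'n, 't) module_scheme \<Rightarrow> 'm \<Rightarrow> 'n \<Rightarrow> ('m, 'n) tensor"
  where "pure_tensor K M N x y =
    tensor_subgroup K M N #>\<^bsub>free_Abelian_group (carrier M \<times> carrier N)\<^esub> frag_of (x, y)"

text \<open>\<open>tensor_lift K M N G b\<close> is the additive map \<open>M \<otimes> N \<rightarrow> G\<close> sending
  \<open>\<Sum>i. x\<^sub>i \<otimes> y\<^sub>i\<close> to \<open>\<Sum>i. b x\<^sub>i y\<^sub>i\<close>, provided by the universal property when \<open>G\<close> is an abelian group
  (written multiplicatively) and \<open>b\<close> is biadditive and balanced over \<open>K\<close>. An informal term in
  which \<open>z = \<Sum>i. x\<^sub>i \<otimes> y\<^sub>i\<close> is decomposed is written below as a lift applied to \<open>z\<close>.\<close>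

definition tensor_lift :: "('k, 'r) ring_scheme \<Rightarrow> ('k, 'm, 's) module_scheme
    \<Rightarrow> ('k, 'n, 't) module_scheme \<Rightarrow> ('g, 'u) monoid_scheme \<Rightarrow> ('m \<Rightarrow> 'n \<Rightarrow> 'g)
    \<Rightarrow> ('m, 'n) tensor \<Rightarrow> 'g"
  where "tensor_lift K M N G b =
    (THE h. h \<in> hom (tensor_group K M N) G \<and> h \<in> extensional (carrier (tensor_group K M N)) \<and>
      (\<forall>x\<in>carrier M. \<forall>y\<in>carrier N. h (pure_tensor K M N x y) = b x y))"

definition tensor_module :: "('k, 'r) ring_scheme \<Rightarrow> ('k, 'm, 's) module_scheme
    \<Rightarrow> ('k, 'n, 't) module_scheme \<Rightarrow> ('k, ('m, 'n) tensor) module"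
  where "tensor_module K M N =
    \<lparr>carrier = carrier (tensor_group K M N), monoid.mult = undefined, monoid.one = undefined,
     ring.zero = \<one>\<^bsub>tensor_group K M N\<^esub>, ring.add = monoid.mult (tensor_group K M N),
     smult = (\<lambda>c. tensor_lift K M N (tensor_group K M N)
                    (\<lambda>x y. pure_tensor K M N (c \<odot>\<^bsub>M\<^esub> x) y))\<rparr>"

definition tensor_map :: "('k, 'r) ring_scheme
    \<Rightarrow> ('k, 'm, 's) module_scheme \<Rightarrow> ('k, 'n, 't) module_scheme
    \<Rightarrow> ('k, 'p, 'u) module_scheme \<Rightarrow> ('k, 'q, 'w) module_scheme
    \<Rightarrow> ('m \<Rightarrow> 'p) \<Rightarrow> ('n \<Rightarrow> 'q) \<Rightarrow> ('m, 'n) tensor \<Rightarrow> ('p, 'q) tensor"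
  where "tensor_map K M N P Q f h =
    tensor_lift K M N (tensor_group K P Q) (\<lambda>x y. pure_tensor K P Q (f x) (h y))"

text \<open>For an \<open>A\<close>-bimodule \<open>M\<close> and a \<open>B\<close>-bimodule \<open>N\<close>, the factorwise \<open>A \<otimes> B\<close>-bimodule \<open>M \<otimes> N\<close>:
  \<open>(a \<otimes> b)(x \<otimes> y)(c \<otimes> d) = axc \<otimes> byd\<close>.\<close>

definition tensor_bimodule :: "('k, 'r) ring_scheme
    \<Rightarrow> ('k, 'a, 's) module_scheme \<Rightarrow> ('k, 'b, 't) module_scheme
    \<Rightarrow> ('k, 'a, 'm, 'u) bimod_scheme \<Rightarrow> ('k, 'b, 'n, 'w) bimod_scheme
    \<Rightarrow> ('k, ('a, 'b) tensor, ('m, 'n) tensor) bimod"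
  where "tensor_bimodule K A B M N =
    \<lparr>carrier = carrier (tensor_module K M N), monoid.mult = undefined, monoid.one = undefined,
     ring.zero = \<zero>\<^bsub>tensor_module K M N\<^esub>, ring.add = add (tensor_module K M N),
     smult = smult (tensor_module K M N),
     lact = (\<lambda>t z. tensor_lift K A B (tensor_group K M N)
               (\<lambda>a b. tensor_map K M N M N (lact M a) (lact N b) z) t),
     ract = (\<lambda>z t. tensor_lift K A B (tensor_group K M N)
               (\<lambda>a b. tensor_map K M N M N (\<lambda>x. ract M x a) (\<lambda>y. ract N y b) z) t)\<rparr>"

text \<open>Triple tensor products \<open>M \<otimes> N \<otimes> P\<close> are bracketed as \<open>M \<otimes> (N \<otimes> P)\<close>.\<close>

definition tensor3_group :: "('k, 'r) ring_scheme \<Rightarrow> ('k, 'm, 's) module_scheme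
    \<Rightarrow> ('k, 'n, 't) module_scheme \<Rightarrow> ('k, 'p, 'u) module_scheme \<Rightarrow> ('m, ('n, 'p) tensor) tensor monoid"
  where "tensor3_group K M N P = tensor_group K M (tensor_module K N P)"

definition pure_tensor3 :: "('k, 'r) ring_scheme \<Rightarrow> ('k, 'm, 's) module_scheme
    \<Rightarrow> ('k, 'n, 't) module_scheme \<Rightarrow> ('k, 'p, 'u) module_scheme
    \<Rightarrow> 'm \<Rightarrow> 'n \<Rightarrow> 'p \<Rightarrow> ('m, ('n, 'p) tensor) tensor"
  where "pure_tensor3 K M N P x y z =
    pure_tensor K M (tensor_module K N P) x (pure_tensor K N P y z)"

definition tensor3_lift :: "('k, 'r) ring_scheme \<Rightarrow> ('k, 'm, 's) module_scheme
    \<Rightarrow> ('k, 'n, 't) module_scheme \<Rightarrow> ('k, 'p, 'u) module_scheme \<Rightarrow> ('g, 'w) monoid_scheme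
    \<Rightarrow> ('m \<Rightarrow> 'n \<Rightarrow> 'p \<Rightarrow> 'g) \<Rightarrow> ('m, ('n, 'p) tensor) tensor \<Rightarrow> 'g"
  where "tensor3_lift K M N P G b =
    tensor_lift K M (tensor_module K N P) G (\<lambda>x. tensor_lift K N P G (b x))"


section \<open>Categories\<close>

text \<open>Hom-sets need not be disjoint; composition, identities and the morphism part of a functor
  take the source and target objects as explicit arguments.\<close>

record ('o, 'm) category =
  Obj :: "'o set"
  Hom :: "'o \<Rightarrow> 'o \<Rightarrow> 'm set"
  Id :: "'o \<Rightarrow> 'm"
  Comp :: "'o \<Rightarrow> 'o \<Rightarrow> 'o \<Rightarrow> 'm \<Rightarrow> 'm \<Rightarrow> 'm"

definition is_category :: "('o, 'm) category \<Rightarrow> bool"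
  where "is_category C \<longleftrightarrow>
    (\<forall>X\<in>Obj C. Id C X \<in> Hom C X X) \<and>
    (\<forall>X\<in>Obj C. \<forall>Y\<in>Obj C. \<forall>Z\<in>Obj C. \<forall>f\<in>Hom C X Y. \<forall>g\<in>Hom C Y Z.
       Comp C X Y Z g f \<in> Hom C X Z) \<and>
    (\<forall>X\<in>Obj C. \<forall>Y\<in>Obj C. \<forall>f\<in>Hom C X Y.
       Comp C X X Y f (Id C X) = f \<and> Comp C X Y Y (Id C Y) f = f) \<and>
    (\<forall>W\<in>Obj C. \<forall>X\<in>Obj C. \<forall>Y\<in>Obj C. \<forall>Z\<in>Obj C.
       \<forall>f\<in>Hom C W X. \<forall>g\<in>Hom C X Y. \<forall>h\<in>Hom C Y Z.
       Comp C W X Z (Comp C X Y Z h g) f = Comp C W Y Z h (Comp C W X Y g f))"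

definition is_functor :: "('o, 'm) category \<Rightarrow> ('p, 'n) category
    \<Rightarrow> ('o \<Rightarrow> 'p) \<Rightarrow> ('o \<Rightarrow> 'o \<Rightarrow> 'm \<Rightarrow> 'n) \<Rightarrow> bool"
  where "is_functor C D Fo Fm \<longleftrightarrow>
    (\<forall>X\<in>Obj C. Fo X \<in> Obj D \<and> Fm X X (Id C X) = Id D (Fo X)) \<and>
    (\<forall>X\<in>Obj C. \<forall>Y\<in>Obj C. \<forall>f\<in>Hom C X Y. Fm X Y f \<in> Hom D (Fo X) (Fo Y)) \<and>
    (\<forall>X\<in>Obj C. \<forall>Y\<in>Obj C. \<forall>Z\<in>Obj C. \<forall>f\<in>Hom C X Y. \<forall>g\<in>Hom C Y Z.
       Fm X Z (Comp C X Y Z g f) = Comp D (Fo X) (Fo Y) (Fo Z) (Fm Y Z g) (Fm X Y f))"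

definition isomorphic_categories :: "('o, 'm) category \<Rightarrow> ('p, 'n) category \<Rightarrow> bool"
  where "isomorphic_categories C D \<longleftrightarrow> (\<exists>Fo Fm Go Gm.
    is_functor C D Fo Fm \<and> is_functor D C Go Gm \<and>
    (\<forall>X\<in>Obj C. Go (Fo X) = X) \<and>
    (\<forall>X\<in>Obj C. \<forall>Y\<in>Obj C. \<forall>f\<in>Hom C X Y. Gm (Fo X) (Fo Y) (Fm X Y f) = f) \<and>
    (\<forall>X\<in>Obj D. Fo (Go X) = X) \<and>
    (\<forall>X\<in>Obj D. \<forall>Y\<in>Obj D. \<forall>f\<in>Hom D X Y. Fm (Go X) (Go Y) (Gm X Y f) = f))"


section \<open>Descent data\<close>

text \<open>In both categories the objects have underlying sets contained in the type \<open>'v\<close>,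
  which plays the role of the universe.\<close>

type_synonym ('k, 'a, 'v) desc_object =
  "('k, 'a, 'v) bimod \<times> (('a, 'v) tensor \<Rightarrow> ('v, 'a) tensor)"

definition descent_map1 :: "('k, 'r) ring_scheme \<Rightarrow> ('k, 'a, 's) module_scheme
    \<Rightarrow> ('k, 'a, 'v) bimod \<Rightarrow> (('a, 'v) tensor \<Rightarrow> ('v, 'a) tensor)
    \<Rightarrow> ('a, ('a, 'v) tensor) tensor \<Rightarrow> ('a, ('v, 'a) tensor) tensor"
  where "descent_map1 K A V g = tensor3_lift K A A V (tensor3_group K A V A)
    (\<lambda>b a v. tensor_lift K V A (tensor3_group K A V A)
       (\<lambda>w x. pure_tensor3 K A V A b w x) (g (pure_tensor K A V a v)))"

definition descent_map2 :: "('k, 'r) ring_scheme \<Rightarrow> ('k, 'a, 's) module_scheme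
    \<Rightarrow> ('k, 'a, 'v) bimod \<Rightarrow> (('a, 'v) tensor \<Rightarrow> ('v, 'a) tensor)
    \<Rightarrow> ('a, ('a, 'v) tensor) tensor \<Rightarrow> ('v, ('a, 'a) tensor) tensor"
  where "descent_map2 K A V g = tensor3_lift K A A V (tensor3_group K V A A)
    (\<lambda>a b v. tensor_lift K V A (tensor3_group K V A A)
       (\<lambda>w x. pure_tensor3 K V A A w b x) (g (pure_tensor K A V a v)))"

definition descent_map3 :: "('k, 'r) ring_scheme \<Rightarrow> ('k, 'a, 's) module_scheme
    \<Rightarrow> ('k, 'a, 'v) bimod \<Rightarrow> (('a, 'v) tensor \<Rightarrow> ('v, 'a) tensor)
    \<Rightarrow> ('a, ('v, 'a) tensor) tensor \<Rightarrow> ('v, ('a, 'a) tensor) tensor"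
  where "descent_map3 K A V g = tensor3_lift K A V A (tensor3_group K V A A)
    (\<lambda>a v b. tensor_lift K V A (tensor3_group K V A A)
       (\<lambda>w x. pure_tensor3 K V A A w x b) (g (pure_tensor K A V a v)))"

definition right_mult_map :: "('k, 'r) ring_scheme \<Rightarrow> ('k, 'a, 's) module_scheme
    \<Rightarrow> ('k, 'a, 'v) bimod \<Rightarrow> ('v, 'a) tensor \<Rightarrow> 'v"
  where "right_mult_map K A V = tensor_lift K V A (add_monoid V) (ract V)"

definition is_descent_datum :: "('k, 'r) ring_scheme \<Rightarrow> ('k, 'a, 's) module_scheme
    \<Rightarrow> ('k, 'a, 'v) bimod \<Rightarrow> (('a, 'v) tensor \<Rightarrow> ('v, 'a) tensor) \<Rightarrow> bool"
  where "is_descent_datum K A V g \<longleftrightarrow>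
    g \<in> bimodule_maps (tensor_module K A A)
          (tensor_bimodule K A A (regular_bimodule A) V)
          (tensor_bimodule K A A V (regular_bimodule A)) \<and>
    (\<forall>t\<in>carrier (tensor3_group K A A V).
       descent_map2 K A V g t = descent_map3 K A V g (descent_map1 K A V g t)) \<and>
    (\<forall>v\<in>carrier V. right_mult_map K A V (g (pure_tensor K A V \<one>\<^bsub>A\<^esub> v)) = v)"

definition Desc :: "('k, 'r) ring_scheme \<Rightarrow> ('k, 'a, 's) module_scheme
    \<Rightarrow> (('k, 'a, 'v) desc_object, 'v \<Rightarrow> 'v) category"
  where "Desc K A =
    \<lparr>Obj = {(V, g). bimodule K A V \<and> normalized K A V \<and> is_descent_datum K A V g},
     Hom = (\<lambda>(V, g) (V', g'). {f \<in> bimodule_maps A V V'.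
       \<forall>t\<in>carrier (tensor_group K A V).
         tensor_map K V A V' A f id (g t) = g' (tensor_map K A V A V' id f t)}),
     Id = (\<lambda>(V, g). restrict id (carrier V)),
     Comp = (\<lambda>(V, g) Y Z. compose (carrier V))\<rparr>"


section \<open>Yetter-Drinfeld modules\<close>

type_synonym ('k, 'a, 'v) yd_object = "('k, 'a, 'v) bimod \<times> ('v \<Rightarrow> ('v, 'a) tensor)"

definition is_yetter_drinfeld :: "('k, 'r) ring_scheme \<Rightarrow> ('k, 'a, 's) module_scheme
    \<Rightarrow> ('k, 'a, 'v) bimod \<Rightarrow> ('v \<Rightarrow> ('v, 'a) tensor) \<Rightarrow> bool"
  where "is_yetter_drinfeld K A V \<rho> \<longleftrightarrow>
    \<rho> \<in> linear_maps K V (tensor_module K V A) \<and>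
    (\<forall>v\<in>carrier V. tensor_lift K V A (add_monoid V) (\<lambda>v0 v1. ract V v0 v1) (\<rho> v) = v) \<and>
    (\<forall>v\<in>carrier V.
       tensor_lift K V A (tensor3_group K V A A)
         (\<lambda>v0 v1. tensor_lift K V A (tensor3_group K V A A)
            (\<lambda>w0 w1. pure_tensor3 K V A A w0 w1 v1) (\<rho> v0)) (\<rho> v)
       = tensor_lift K V A (tensor3_group K V A A)
           (\<lambda>v0 v1. pure_tensor3 K V A A v0 \<one>\<^bsub>A\<^esub> v1) (\<rho> v)) \<and>
    (\<forall>v\<in>carrier V. \<forall>a\<in>carrier A.
       \<rho> (ract V v a) = tensor_lift K V A (tensor_group K V A)
         (\<lambda>v0 v1. pure_tensor K V A v0 (v1 \<otimes>\<^bsub>A\<^esub> a)) (\<rho> v)) \<and>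
    (\<forall>v\<in>carrier V. \<forall>a\<in>carrier A.
       \<rho> (lact V a v) = tensor_lift K V A (tensor_group K V A)
         (\<lambda>v0 v1. pure_tensor K V A v0 (a \<otimes>\<^bsub>A\<^esub> v1)) (\<rho> v)) \<and>
    (\<forall>v\<in>carrier V. \<forall>a\<in>carrier A.
       tensor_lift K V A (tensor_group K V A)
         (\<lambda>v0 v1. pure_tensor K V A (lact V a v0) v1) (\<rho> v)
       = tensor_lift K V A (tensor_group K V A)
           (\<lambda>v0 v1. pure_tensor K V A (ract V v0 a) v1) (\<rho> v))"

definition YD :: "('k, 'r) ring_scheme \<Rightarrow> ('k, 'a, 's) module_scheme
    \<Rightarrow> (('k, 'a, 'v) yd_object, 'v \<Rightarrow> 'v) category"
  where "YD K A =
    \<lparr>Obj = {(V, \<rho>). bimodule K A V \<and> normalized K A V \<and> is_yetter_drinfeld K A V \<rho>},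
     Hom = (\<lambda>(V, \<rho>) (V', \<rho>'). {f \<in> bimodule_maps A V V'.
       \<forall>v\<in>carrier V. \<rho>' (f v) = tensor_map K V A V' A f id (\<rho> v)}),
     Id = (\<lambda>(V, \<rho>). restrict id (carrier V)),
     Comp = (\<lambda>(V, \<rho>) Y Z. compose (carrier V))\<rparr>"

end

theory Submission
  imports Defs
begin

text \<open>Both functors are the identity on bimodules and on maps. A descent datum \<open>g\<close> is determined by
  \<open>\<rho> v = g (1 \<otimes> v)\<close>, because left \<open>A \<otimes> A\<close>-linearity forces \<open>g (a \<otimes> v) = a v\<^sub>0 \<otimes> v\<^sub>1\<close>; conversely
  this formula defines \<open>g\<close> from \<open>\<rho>\<close>. Linearity in the second tensor factor gives the conditions on
  \<open>\<rho> (va)\<close> and \<open>\<rho> (av)\<close>, and linearity on the right in the first factor gives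
  \<open>av\<^sub>0 \<otimes> v\<^sub>1 = v\<^sub>0a \<otimes> v\<^sub>1\<close>. On \<open>a \<otimes> b \<otimes> v\<close> the two sides \<open>g\<^sub>2\<close> and \<open>g\<^sub>3 \<circ> g\<^sub>1\<close> of the cocycle condition
  are the images of the two sides of the comodule condition at \<open>v\<close> under
  \<open>w \<otimes> x \<otimes> y \<mapsto> aw \<otimes> bx \<otimes> y\<close>, which is the identity for \<open>a = b = 1\<close>.\<close>

section \<open>Tensor products\<close>

text \<open>Informal formulas in components are encoded by \<open>tensor_lift\<close>, a definite
  description that is usable only after the form being lifted is shown to be balanced. Much of the
  work is therefore bilinearity of such forms; afterwards, identities between tensors follow by
  comparing linear maps on pure tensors. Three points are hidden by the informal computation. A
  descent map is assumed additive and \<open>A \<otimes> A\<close>-linear; its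
  \<open>K\<close>-linearity, needed to compare it with a lift, comes from the action of
  \<open>c1 \<otimes> 1\<close>. For linearity on the right in the first factor,
  \<open>(xa)v0 \<otimes> v1\<close> must be rewritten as \<open>x(v0 a) \<otimes> v1\<close> before
  the bimodule law moves \<open>a\<close> to the outside. The equivalence of the cocycle and
  comodule conditions is derived from linearity of \<open>\<rho>\<close> and its compatibility with
  left multiplication, both available in either direction, so one lemma serves both functors. As the
  functors keep maps fixed, corresponding hom-sets are equal, and the category axioms are verified
  once and transported.\<close>

definition is_linear :: "('k, 'r) ring_scheme \<Rightarrow> ('k, 'm, 's) module_scheme
    \<Rightarrow> ('k, 'n, 't) module_scheme \<Rightarrow> ('m \<Rightarrow> 'n) \<Rightarrow> bool"
  where "is_linear K M N f \<longleftrightarrow>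
    (\<forall>x\<in>carrier M. f x \<in> carrier N) \<and>
    (\<forall>x\<in>carrier M. \<forall>y\<in>carrier M. f (x \<oplus>\<^bsub>M\<^esub> y) = f x \<oplus>\<^bsub>N\<^esub> f y) \<and>
    (\<forall>c\<in>carrier K. \<forall>x\<in>carrier M. f (c \<odot>\<^bsub>M\<^esub> x) = c \<odot>\<^bsub>N\<^esub> f x)"

text \<open>Like \<open>is_linear\<close>, a condition on carriers alone. Leaving out the
  extensionality demanded by \<open>linear_maps\<close> lets bare lambda terms and composites
  qualify without restriction.\<close>

definition is_bilinear :: "('k, 'r) ring_scheme \<Rightarrow> ('k, 'm, 's) module_scheme
    \<Rightarrow> ('k, 'n, 't) module_scheme \<Rightarrow> ('k, 'p, 'u) module_scheme \<Rightarrow> ('m \<Rightarrow> 'n \<Rightarrow> 'p) \<Rightarrow> bool"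
  where "is_bilinear K M N P b \<longleftrightarrow>
    (\<forall>x\<in>carrier M. is_linear K N P (b x)) \<and> (\<forall>y\<in>carrier N. is_linear K M P (\<lambda>x. b x y))"

text \<open>The hypothesis of the universal property as \<open>tensor_lift\<close> needs it: the
  target is a multiplicative group without scalars, so homogeneity is replaced by moving
  \<open>c\<close> across the tensor sign.\<close>

definition is_balanced :: "('k, 'r) ring_scheme \<Rightarrow> ('k, 'm, 's) module_scheme
    \<Rightarrow> ('k, 'n, 't) module_scheme \<Rightarrow> ('g, 'u) monoid_scheme \<Rightarrow> ('m \<Rightarrow> 'n \<Rightarrow> 'g) \<Rightarrow> bool"
  where "is_balanced K M N G b \<longleftrightarrow>
    (\<forall>x\<in>carrier M. \<forall>y\<in>carrier N. b x y \<in> carrier G) \<and>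
    (\<forall>x\<in>carrier M. \<forall>x'\<in>carrier M. \<forall>y\<in>carrier N. b (x \<oplus>\<^bsub>M\<^esub> x') y = b x y \<otimes>\<^bsub>G\<^esub> b x' y) \<and>
    (\<forall>x\<in>carrier M. \<forall>y\<in>carrier N. \<forall>y'\<in>carrier N. b x (y \<oplus>\<^bsub>N\<^esub> y') = b x y \<otimes>\<^bsub>G\<^esub> b x y') \<and>
    (\<forall>c\<in>carrier K. \<forall>x\<in>carrier M. \<forall>y\<in>carrier N. b (c \<odot>\<^bsub>M\<^esub> x) y = b x (c \<odot>\<^bsub>N\<^esub> y))"

text \<open>Additive relators have the shape \<open>a - b - c\<close>. This converts between
  triviality of the image of such a relator and an additivity equation.\<close>

lemma (in comm_group) mult_inv_inv_eq_one_iff: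
  assumes [simp]: "a \<in> carrier G" "b \<in> carrier G" "c \<in> carrier G"
  shows "a \<otimes> inv b \<otimes> inv c = \<one> \<longleftrightarrow> a = b \<otimes> c"
proof -
  have "a \<otimes> inv b \<otimes> inv c = a \<otimes> inv (b \<otimes> c)"
    by (simp add: inv_mult m_assoc)
  then show ?thesis
    using inv_solve_right'[of \<one> a "b \<otimes> c"] by auto
qed

section \<open>The universal property of the tensor product over \<open>K\<close>\<close>

context
  fixes K :: "('k, 'r) ring_scheme" and M :: "('k, 'm, 's) module_scheme"
    and N :: "('k, 'n, 't) module_scheme"
  assumes M: "module K M" and N: "module K N"
begin

interpretation M: module K M by (rule M)
interpretation N: module K N by (rule N)

lemma tensor_relators_carrier:
  "tensor_relators K M N \<subseteq> carrier (free_Abelian_group (carrier M \<times> carrier N))"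
proof
  fix r
  assume "r \<in> tensor_relators K M N"
  then show "r \<in> carrier (free_Abelian_group (carrier M \<times> carrier N))"
    unfolding tensor_relators_def carrier_free_Abelian_group_iff
    by (elim UnE; clarsimp) (auto dest!: subsetD[OF keys_diff])
qed

lemma tensor_subgroup_normal:
  "tensor_subgroup K M N \<lhd> free_Abelian_group (carrier M \<times> carrier N)"
proof -
  interpret F: comm_group "free_Abelian_group (carrier M \<times> carrier N)"
    by (rule abelian_free_Abelian_group)
  show ?thesis
    unfolding tensor_subgroup_def F.normal_iff_subgroup
    by (rule F.generate_is_subgroup[OF tensor_relators_carrier])
qed

lemma tensor_group_comm: "comm_group (tensor_group K M N)"
  unfolding tensor_group_def
  by (rule comm_group.abelian_FactGroup[OF abelian_free_Abelian_group
        normal_imp_subgroup[OF tensor_subgroup_normal]])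

lemma pure_tensor_closed:
  "\<lbrakk>x \<in> carrier M; y \<in> carrier N\<rbrakk> \<Longrightarrow> pure_tensor K M N x y \<in> carrier (tensor_group K M N)"
  by (auto simp: pure_tensor_def tensor_group_def carrier_FactGroup)

lemma coset_hom:
  "(\<lambda>z. tensor_subgroup K M N #>\<^bsub>free_Abelian_group (carrier M \<times> carrier N)\<^esub> z)
     \<in> hom (free_Abelian_group (carrier M \<times> carrier N)) (tensor_group K M N)"
  unfolding tensor_group_def by (rule normal.r_coset_hom_Mod[OF tensor_subgroup_normal])

lemma coset_relator:
  assumes "r \<in> tensor_relators K M N"
  shows "tensor_subgroup K M N #>\<^bsub>free_Abelian_group (carrier M \<times> carrier N)\<^esub> r = \<one>\<^bsub>tensor_group K M N\<^esub>"
proof -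
  interpret F: comm_group "free_Abelian_group (carrier M \<times> carrier N)"
    by (rule abelian_free_Abelian_group)
  have "r \<in> tensor_subgroup K M N"
    unfolding tensor_subgroup_def using assms by (rule generate.incl)
  then show ?thesis
    unfolding tensor_group_def one_FactGroup
    using subgroup.mem_carrier[OF normal_imp_subgroup[OF tensor_subgroup_normal]]
    by (intro F.coset_join2 normal_imp_subgroup[OF tensor_subgroup_normal])
qed

text \<open>Relators and the induction rule for free abelian groups are phrased with subtraction,
  whereas the target group is multiplicative.\<close>

lemma hom_free_diff:
  assumes "group G" "h \<in> hom (free_Abelian_group S) G"
    and "a \<in> carrier (free_Abelian_group S)" "b \<in> carrier (free_Abelian_group S)"
  shows "h (a - b) = h a \<otimes>\<^bsub>G\<^esub> inv\<^bsub>G\<^esub> (h b)"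
proof -
  interpret group_hom "free_Abelian_group S" G h
    using assms by (simp add: group_hom_def group_hom_axioms_def)
  have "h (a - b) = h (a \<otimes>\<^bsub>free_Abelian_group S\<^esub> inv\<^bsub>free_Abelian_group S\<^esub> b)"
    using assms by simp
  then show ?thesis
    using assms(3,4) by (simp only: hom_mult hom_inv G.inv_closed hom_closed)
qed

lemma pure_tensor_balanced: "is_balanced K M N (tensor_group K M N) (pure_tensor K M N)"
proof -
  let ?F = "free_Abelian_group (carrier M \<times> carrier N)"
  interpret T: comm_group "tensor_group K M N" by (rule tensor_group_comm)
  note diff = hom_free_diff[OF T.is_group coset_hom]
  \<comment> \<open>A relator has trivial coset. Expanding that coset by two uses of
    \<open>hom_free_diff\<close> gives an equation between cosets of generators, of which both
    additivity clauses are instances.\<close>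
  have split3: "pure_tensor K M N x y = pure_tensor K M N x' y' \<otimes>\<^bsub>tensor_group K M N\<^esub> pure_tensor K M N x'' y''"
    if c: "x \<in> carrier M" "x' \<in> carrier M" "x'' \<in> carrier M"
          "y \<in> carrier N" "y' \<in> carrier N" "y'' \<in> carrier N"
      and r: "frag_of (x, y) - frag_of (x', y') - frag_of (x'', y'') \<in> tensor_relators K M N"
    for x y x' y' x'' y''
  proof -
    have m: "frag_of (x, y) \<in> carrier ?F" "frag_of (x', y') \<in> carrier ?F" "frag_of (x'', y'') \<in> carrier ?F"
      using c by auto
    then have d: "frag_of (x, y) - frag_of (x', y') \<in> carrier ?F"
      by (auto dest!: subsetD[OF keys_diff])
    show ?thesis
      using coset_relator[OF r] c unfolding diff[OF d m(3)] diff[OF m(1) m(2)]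
      by (simp add: T.mult_inv_inv_eq_one_iff pure_tensor_closed flip: pure_tensor_def)
  qed
  have split2: "pure_tensor K M N x y = pure_tensor K M N x' y'"
    if c: "x \<in> carrier M" "x' \<in> carrier M" "y \<in> carrier N" "y' \<in> carrier N"
      and r: "frag_of (x, y) - frag_of (x', y') \<in> tensor_relators K M N"
    for x y x' y'
  proof -
    have m: "frag_of (x, y) \<in> carrier ?F" "frag_of (x', y') \<in> carrier ?F"
      using c by auto
    \<comment> \<open>The scalar relator has only two terms; it is the case of
      \<open>mult_inv_inv_eq_one_iff\<close> whose third argument is the unit.\<close>
    show ?thesis
      using coset_relator[OF r] c T.mult_inv_inv_eq_one_iff[of "pure_tensor K M N x y" "pure_tensor K M N x' y'" "\<one>\<^bsub>tensor_group K M N\<^esub>"]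
      unfolding diff[OF m(1) m(2)]
      by (simp add: pure_tensor_closed flip: pure_tensor_def)
  qed
  show ?thesis
    unfolding is_balanced_def
  proof (intro conjI ballI)
    fix c x y assume "c \<in> carrier K" "x \<in> carrier M" "y \<in> carrier N"
    then show "pure_tensor K M N (c \<odot>\<^bsub>M\<^esub> x) y = pure_tensor K M N x (c \<odot>\<^bsub>N\<^esub> y)"
      by (intro split2) (auto simp: tensor_relators_def)
  next
    fix x x' y assume "x \<in> carrier M" "x' \<in> carrier M" "y \<in> carrier N"
    then show "pure_tensor K M N (x \<oplus>\<^bsub>M\<^esub> x') y = pure_tensor K M N x y \<otimes>\<^bsub>tensor_group K M N\<^esub> pure_tensor K M N x' y"
      by (intro split3) (auto simp: tensor_relators_def)
  next
    fix x y y' assume "x \<in> carrier M" "y \<in> carrier N" "y' \<in> carrier N"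
    then show "pure_tensor K M N x (y \<oplus>\<^bsub>N\<^esub> y') = pure_tensor K M N x y \<otimes>\<^bsub>tensor_group K M N\<^esub> pure_tensor K M N x y'"
      by (intro split3) (auto simp: tensor_relators_def)
  qed (rule pure_tensor_closed)
qed

text \<open>Every element of the quotient is the coset of a formal combination of pairs. After
  pulling both homomorphisms back to the free group, induction reduces the claim to generators,
  whose cosets are the pure tensors.\<close>

lemma tensor_hom_eqI:
  assumes "group G" and h: "h \<in> hom (tensor_group K M N) G" and h': "h' \<in> hom (tensor_group K M N) G"
    and eq: "\<And>x y. \<lbrakk>x \<in> carrier M; y \<in> carrier N\<rbrakk>
      \<Longrightarrow> h (pure_tensor K M N x y) = h' (pure_tensor K M N x y)"
    and z: "z \<in> carrier (tensor_group K M N)"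
  shows "h z = h' z"
proof -
  let ?F = "free_Abelian_group (carrier M \<times> carrier N)"
  let ?q = "\<lambda>z. tensor_subgroup K M N #>\<^bsub>?F\<^esub> z"
  interpret F: group ?F by simp
  interpret G: group G by fact
  have comp: "(\<lambda>z. h (?q z)) \<in> hom ?F G" "(\<lambda>z. h' (?q z)) \<in> hom ?F G"
    using Group.hom_compose[OF coset_hom h] Group.hom_compose[OF coset_hom h'] by (simp_all add: comp_def)
  obtain w where w: "w \<in> carrier ?F" "z = ?q w"
    using z by (auto simp: tensor_group_def carrier_FactGroup)
  have "Poly_Mapping.keys w \<subseteq> carrier M \<times> carrier N"
    using w(1) by simp
  then have "h (?q w) = h' (?q w)"
  proof (rule free_Abelian_group_induct)
    show "h (?q 0) = h' (?q 0)"
      using hom_one[OF comp(1) F.is_group G.is_group] hom_one[OF comp(2) F.is_group G.is_group] by simp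
  next
    fix x y
    assume "Poly_Mapping.keys x \<subseteq> carrier M \<times> carrier N" "Poly_Mapping.keys y \<subseteq> carrier M \<times> carrier N"
      "h (?q x) = h' (?q x)" "h (?q y) = h' (?q y)"
    then show "h (?q (x - y)) = h' (?q (x - y))"
      using hom_free_diff[OF G.is_group comp(1)] hom_free_diff[OF G.is_group comp(2)] by simp
  next
    fix a
    assume "a \<in> carrier M \<times> carrier N"
    then show "h (?q (frag_of a)) = h' (?q (frag_of a))" using eq by (auto simp: pure_tensor_def)
  qed
  then show ?thesis by (simp add: w)
qed

text \<open>\<open>b\<close> extends freely to formal combinations; balancedness makes the extension
  kill the relators, so it factors through the quotient. Restriction to the carrier makes the factor
  extensional.\<close>

lemma tensor_hom_exists:
  assumes "comm_group G" and b: "is_balanced K M N G b"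
  shows "\<exists>h. h \<in> hom (tensor_group K M N) G \<and> h \<in> extensional (carrier (tensor_group K M N)) \<and>
      (\<forall>x\<in>carrier M. \<forall>y\<in>carrier N. h (pure_tensor K M N x y) = b x y)"
proof -
  let ?F = "free_Abelian_group (carrier M \<times> carrier N)"
  let ?S = "tensor_subgroup K M N"
  interpret F: comm_group ?F by (rule abelian_free_Abelian_group)
  interpret G: comm_group G by fact
  have "case_prod b ` (carrier M \<times> carrier N) \<subseteq> carrier G"
    using b by (auto simp: is_balanced_def)
  then obtain h where h: "h \<in> hom ?F G"
    and hb: "\<And>p. p \<in> carrier M \<times> carrier N \<Longrightarrow> h (frag_of p) = case_prod b p"
    by (rule G.free_Abelian_group_universal) blast
  interpret h: group_hom ?F G h using h by (simp add: group_hom_def group_hom_axioms_def)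
  have bcl: "b x y \<in> carrier G" if "x \<in> carrier M" "y \<in> carrier N" for x y
    using b that by (simp add: is_balanced_def)
  have two: "Poly_Mapping.keys (frag_of p - frag_of q) \<subseteq> carrier M \<times> carrier N"
    if "p \<in> carrier M \<times> carrier N" "q \<in> carrier M \<times> carrier N" for p q
    using that by (auto dest!: subsetD[OF keys_diff])
  have "r \<in> kernel ?F G h" if r: "r \<in> tensor_relators K M N" for r
  proof -
    have "h r = \<one>\<^bsub>G\<^esub>"
      using r b unfolding tensor_relators_def is_balanced_def
      by (elim UnE; clarsimp)
        (simp_all add: hom_free_diff[OF G.is_group h] two hb bcl G.mult_inv_inv_eq_one_iff)
    then show ?thesis
      using subsetD[OF tensor_relators_carrier r] unfolding kernel_def by blast
  qed
  then have ker: "?S \<subseteq> kernel ?F G h"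
    unfolding tensor_subgroup_def by (intro F.generate_subgroup_incl h.subgroup_kernel subsetI)
  obtain g where g: "g \<in> hom (?F Mod ?S) G" "\<And>z. z \<in> carrier ?F \<Longrightarrow> g (?S #>\<^bsub>?F\<^esub> z) = h z"
    by (rule h.FactGroup_universal_kernel[OF tensor_subgroup_normal ker]) blast
  have "restrict g (carrier (tensor_group K M N)) \<in> hom (tensor_group K M N) G"
    using g(1) comm_group.axioms(2)[OF tensor_group_comm]
    by (simp add: tensor_group_def group.hom_restrict)
  moreover have "restrict g (carrier (tensor_group K M N)) (pure_tensor K M N x y) = b x y"
    if "x \<in> carrier M" "y \<in> carrier N" for x y
    using that hb[of "(x, y)"] g(2)[of "frag_of (x, y)"] pure_tensor_closed[OF that] by (simp add: pure_tensor_def)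
  ultimately show ?thesis
    by (intro exI[of _ "restrict g (carrier (tensor_group K M N))"]) (simp del: restrict_apply)
qed

text \<open>Existence and uniqueness justify the definite description behind
  \<open>tensor_lift\<close>. Uniqueness as a function, also outside the carrier, relies on the
  extensionality clause.\<close>

lemma tensor_lift_balanced:
  assumes "comm_group G" and b: "is_balanced K M N G b"
  shows "tensor_lift K M N G b \<in> hom (tensor_group K M N) G"
    and "tensor_lift K M N G b \<in> extensional (carrier (tensor_group K M N))"
    and "\<lbrakk>x \<in> carrier M; y \<in> carrier N\<rbrakk> \<Longrightarrow> tensor_lift K M N G b (pure_tensor K M N x y) = b x y"
proof -
  have "\<exists>!h. h \<in> hom (tensor_group K M N) G \<and> h \<in> extensional (carrier (tensor_group K M N)) \<and>
      (\<forall>x\<in>carrier M. \<forall>y\<in>carrier N. h (pure_tensor K M N x y) = b x y)"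
  proof (rule ex_ex1I[OF tensor_hom_exists[OF assms]])
    interpret G: comm_group G by fact
    fix h h'
    assume h: "h \<in> hom (tensor_group K M N) G \<and> h \<in> extensional (carrier (tensor_group K M N)) \<and>
        (\<forall>x\<in>carrier M. \<forall>y\<in>carrier N. h (pure_tensor K M N x y) = b x y)"
      and h': "h' \<in> hom (tensor_group K M N) G \<and> h' \<in> extensional (carrier (tensor_group K M N)) \<and>
        (\<forall>x\<in>carrier M. \<forall>y\<in>carrier N. h' (pure_tensor K M N x y) = b x y)"
    have "h z = h' z" if "z \<in> carrier (tensor_group K M N)" for z
      by (rule tensor_hom_eqI[OF G.is_group _ _ _ that]) (use h h' in simp_all)
    then show "h = h'"
      using h h' by (meson extensionalityI)
  qed
  from theI'[OF this, folded tensor_lift_def]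
  show "tensor_lift K M N G b \<in> hom (tensor_group K M N) G"
    and "tensor_lift K M N G b \<in> extensional (carrier (tensor_group K M N))"
    and "\<lbrakk>x \<in> carrier M; y \<in> carrier N\<rbrakk> \<Longrightarrow> tensor_lift K M N G b (pure_tensor K M N x y) = b x y"
    by blast+
qed

end

section \<open>Linear and bilinear maps\<close>

lemma is_linearI:
  assumes "\<And>x. x \<in> carrier M \<Longrightarrow> f x \<in> carrier N"
    and "\<And>x y. \<lbrakk>x \<in> carrier M; y \<in> carrier M\<rbrakk> \<Longrightarrow> f (x \<oplus>\<^bsub>M\<^esub> y) = f x \<oplus>\<^bsub>N\<^esub> f y"
    and "\<And>c x. \<lbrakk>c \<in> carrier K; x \<in> carrier M\<rbrakk> \<Longrightarrow> f (c \<odot>\<^bsub>M\<^esub> x) = c \<odot>\<^bsub>N\<^esub> f x"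
  shows "is_linear K M N f"
  using assms by (simp add: is_linear_def)

lemma
  assumes "is_linear K M N f"
  shows linear_closed: "x \<in> carrier M \<Longrightarrow> f x \<in> carrier N"
    and linear_add: "\<lbrakk>x \<in> carrier M; y \<in> carrier M\<rbrakk> \<Longrightarrow> f (x \<oplus>\<^bsub>M\<^esub> y) = f x \<oplus>\<^bsub>N\<^esub> f y"
    and linear_smult: "\<lbrakk>c \<in> carrier K; x \<in> carrier M\<rbrakk> \<Longrightarrow> f (c \<odot>\<^bsub>M\<^esub> x) = c \<odot>\<^bsub>N\<^esub> f x"
  using assms by (simp_all add: is_linear_def)

lemma linear_hom: "is_linear K M N f \<Longrightarrow> f \<in> hom (add_monoid M) (add_monoid N)"
  by (simp add: is_linear_def hom_def)

lemma linear_ident: "is_linear K M M (\<lambda>x. x)"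
  by (simp add: is_linear_def)

lemma linear_comp: "\<lbrakk>is_linear K N P h; is_linear K M N f\<rbrakk> \<Longrightarrow> is_linear K M P (\<lambda>x. h (f x))"
  by (simp add: is_linear_def)

lemma linear_cong:
  assumes "module K M" and "\<And>x. x \<in> carrier M \<Longrightarrow> f x = f' x"
  shows "is_linear K M N f \<longleftrightarrow> is_linear K M N f'"
proof -
  interpret M: module K M by fact
  show ?thesis using assms(2) by (simp add: is_linear_def)
qed

lemma bilinearI:
  assumes "\<And>x. x \<in> carrier M \<Longrightarrow> is_linear K N P (b x)"
    and "\<And>y. y \<in> carrier N \<Longrightarrow> is_linear K M P (\<lambda>x. b x y)"
  shows "is_bilinear K M N P b"
  using assms by (simp add: is_bilinear_def)

lemma
  assumes "is_bilinear K M N P b"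
  shows bilinear_left: "y \<in> carrier N \<Longrightarrow> is_linear K M P (\<lambda>x. b x y)"
    and bilinear_right: "x \<in> carrier M \<Longrightarrow> is_linear K N P (b x)"
    and bilinear_flip: "is_bilinear K N M P (\<lambda>y x. b x y)"
  using assms by (simp_all add: is_bilinear_def is_linear_def)

lemma bilinear_comp:
  "\<lbrakk>is_bilinear K M N P b; is_linear K M' M f; is_linear K N' N h\<rbrakk>
    \<Longrightarrow> is_bilinear K M' N' P (\<lambda>x y. b (f x) (h y))"
  by (simp add: is_bilinear_def is_linear_def)

lemma linear_bilinear:
  "\<lbrakk>is_linear K P Q h; is_bilinear K M N P b\<rbrakk> \<Longrightarrow> is_bilinear K M N Q (\<lambda>x y. h (b x y))"
  by (simp add: is_bilinear_def is_linear_def)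

lemma bilinear_balanced:
  assumes "is_bilinear K M N P b"
  shows "is_balanced K M N (add_monoid P) b"
  using assms by (simp add: is_bilinear_def is_linear_def is_balanced_def)

lemma smult_linear:
  assumes "module K M" "c \<in> carrier K"
  shows "is_linear K M M (smult M c)"
proof -
  interpret M: module K M by fact
  show ?thesis
    using assms(2)
    by (intro is_linearI) (auto simp: M.smult_r_distr M.R.m_comm simp flip: M.smult_assoc1)
qed

abbreviation tlift :: "('k, 'r) ring_scheme \<Rightarrow> ('k, 'm, 's) module_scheme
    \<Rightarrow> ('k, 'n, 't) module_scheme \<Rightarrow> ('k, 'p, 'u) module_scheme \<Rightarrow> ('m \<Rightarrow> 'n \<Rightarrow> 'p)
    \<Rightarrow> ('m, 'n) tensor \<Rightarrow> 'p"
  where "tlift K M N P \<equiv> tensor_lift K M N (add_monoid P)"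

lemma tensor_module_sel [simp]:
  "carrier (tensor_module K M N) = carrier (tensor_group K M N)"
  "\<zero>\<^bsub>tensor_module K M N\<^esub> = \<one>\<^bsub>tensor_group K M N\<^esub>"
  "add (tensor_module K M N) = monoid.mult (tensor_group K M N)"
  by (simp_all add: tensor_module_def)

text \<open>The definitions lift into \<open>tensor_group\<close> and \<open>tensor3_group\<close>,
  the linear algebra into the \<open>add_monoid\<close> of a module. \<open>tensor_lift\<close> sees
  its target only through \<open>hom\<close>, hence only through carrier and multiplication.\<close>

lemma tensor_lift_same_group:
  assumes "carrier G = carrier H" "monoid.mult G = monoid.mult H"
  shows "tensor_lift K M N G b = tensor_lift K M N H b"
  using assms by (simp add: tensor_lift_def hom_def)

lemma tensor_lift_tensor_group:
  "tensor_lift K M N (tensor_group K P Q) b = tlift K M N (tensor_module K P Q) b"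
  by (rule tensor_lift_same_group) simp_all

lemma tensor_lift_tensor3_group:
  "tensor_lift K M N (tensor3_group K P Q R) b
    = tlift K M N (tensor_module K P (tensor_module K Q R)) b"
  by (simp add: tensor3_group_def tensor_lift_tensor_group)

lemma tensor_lift_cong:
  assumes "\<And>x y. \<lbrakk>x \<in> carrier M; y \<in> carrier N\<rbrakk> \<Longrightarrow> b x y = b' x y"
  shows "tensor_lift K M N G b = tensor_lift K M N G b'"
  using assms by (simp add: tensor_lift_def)

section \<open>The \<open>K\<close>-module structure on tensor products and linear lifts\<close>

context
  fixes K :: "('k, 'r) ring_scheme" and M :: "('k, 'm, 's) module_scheme"
    and N :: "('k, 'n, 't) module_scheme"
  assumes M: "module K M" and N: "module K N"
begin

interpretation M: module K M by (rule M)
interpretation N: module K N by (rule N)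

text \<open>The scalar action on tensors is itself a lift, with \<open>c\<close> acting on the left
  factor, so this must precede every statement about that action.\<close>

lemma scaled_pure_tensor_balanced:
  assumes c: "c \<in> carrier K"
  shows "is_balanced K M N (tensor_group K M N) (\<lambda>x y. pure_tensor K M N (c \<odot>\<^bsub>M\<^esub> x) y)"
  using pure_tensor_balanced[OF M N] c smult_linear[OF M c]
  by (simp add: is_balanced_def linear_add linear_smult)

lemma smult_tensor_hom:
  "c \<in> carrier K \<Longrightarrow> smult (tensor_module K M N) c \<in> hom (tensor_group K M N) (tensor_group K M N)"
  by (simp add: tensor_module_def
      tensor_lift_balanced(1)[OF M N tensor_group_comm[OF M N] scaled_pure_tensor_balanced])

lemma smult_pure_tensor:
  "\<lbrakk>c \<in> carrier K; x \<in> carrier M; y \<in> carrier N\<rbrakk>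
    \<Longrightarrow> c \<odot>\<^bsub>tensor_module K M N\<^esub> pure_tensor K M N x y = pure_tensor K M N (c \<odot>\<^bsub>M\<^esub> x) y"
  by (simp add: tensor_module_def
      tensor_lift_balanced(3)[OF M N tensor_group_comm[OF M N] scaled_pure_tensor_balanced])

text \<open>Additivity in the tensor is the homomorphism property of the scalar action. In each
  remaining scalar law both sides are endomorphisms of the tensor group, so agreement on pure
  tensors suffices.\<close>

lemma tensor_module_module: "module K (tensor_module K M N)"
proof -
  let ?T = "tensor_group K M N"
  interpret T: comm_group ?T by (rule tensor_group_comm[OF M N])
  note ext = tensor_hom_eqI[OF M N T.is_group]
  note hom = smult_tensor_hom
  \<comment> \<open>Pointwise products of homomorphisms are homomorphisms because the target is
    commutative.\<close>
  have mult: "(\<lambda>z. h z \<otimes>\<^bsub>?T\<^esub> h' z) \<in> hom ?T ?T" if "h \<in> hom ?T ?T" "h' \<in> hom ?T ?T" for h h'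
    using that hom_in_carrier[OF that(1)] hom_in_carrier[OF that(2)]
    by (auto simp: hom_def Pi_iff T.m_ac)
  have comp: "(\<lambda>z. h (h' z)) \<in> hom ?T ?T" if "h \<in> hom ?T ?T" "h' \<in> hom ?T ?T" for h h'
    using that by (auto simp: hom_def Pi_iff)
  have id: "(\<lambda>z. z) \<in> hom ?T ?T" by (simp add: hom_def)
  have bal: "pure_tensor K M N (x \<oplus>\<^bsub>M\<^esub> x') y = pure_tensor K M N x y \<otimes>\<^bsub>?T\<^esub> pure_tensor K M N x' y"
    if "x \<in> carrier M" "x' \<in> carrier M" "y \<in> carrier N" for x x' y
    using pure_tensor_balanced[OF M N] that by (simp add: is_balanced_def)
  show ?thesis
  proof (rule moduleI)
    show "cring K" by (rule M.R.is_cring)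
    show "abelian_group (tensor_module K M N)"
      by (rule abelian_groupI) (simp_all add: T.m_assoc T.m_comm T.m_lcomm T.l_inv_ex)
  next
    fix c z assume c: "c \<in> carrier K" and z: "z \<in> carrier (tensor_module K M N)"
    then show "c \<odot>\<^bsub>tensor_module K M N\<^esub> z \<in> carrier (tensor_module K M N)"
      using hom_in_carrier[OF hom[OF c]] by simp
  next
    fix c d z assume c: "c \<in> carrier K" "d \<in> carrier K" and z: "z \<in> carrier (tensor_module K M N)"
    show "(c \<oplus>\<^bsub>K\<^esub> d) \<odot>\<^bsub>tensor_module K M N\<^esub> z
        = c \<odot>\<^bsub>tensor_module K M N\<^esub> z \<oplus>\<^bsub>tensor_module K M N\<^esub> d \<odot>\<^bsub>tensor_module K M N\<^esub> z"
      unfolding tensor_module_sel(3)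
      by (rule ext[of _ _ z]) (use c z in \<open>simp_all add: hom mult smult_pure_tensor M.smult_l_distr bal\<close>)
    show "(c \<otimes>\<^bsub>K\<^esub> d) \<odot>\<^bsub>tensor_module K M N\<^esub> z = c \<odot>\<^bsub>tensor_module K M N\<^esub> (d \<odot>\<^bsub>tensor_module K M N\<^esub> z)"
      by (rule ext[of _ _ z]) (use c z in \<open>simp_all add: hom comp smult_pure_tensor M.smult_assoc1\<close>)
  next
    fix c z z'
    assume "c \<in> carrier K" "z \<in> carrier (tensor_module K M N)" "z' \<in> carrier (tensor_module K M N)"
    then show "c \<odot>\<^bsub>tensor_module K M N\<^esub> (z \<oplus>\<^bsub>tensor_module K M N\<^esub> z')
        = c \<odot>\<^bsub>tensor_module K M N\<^esub> z \<oplus>\<^bsub>tensor_module K M N\<^esub> c \<odot>\<^bsub>tensor_module K M N\<^esub> z'"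
      using hom_mult[OF hom] by simp
  next
    fix z assume z: "z \<in> carrier (tensor_module K M N)"
    show "\<one>\<^bsub>K\<^esub> \<odot>\<^bsub>tensor_module K M N\<^esub> z = z"
      by (rule ext[of _ _ z]) (use z in \<open>simp_all add: hom id smult_pure_tensor\<close>)
  qed
qed

lemma pure_tensor_bilinear: "is_bilinear K M N (tensor_module K M N) (pure_tensor K M N)"
  using pure_tensor_balanced[OF M N]
  by (intro bilinearI is_linearI) (auto simp: is_balanced_def smult_pure_tensor)

lemma linear_tensor_eqI:
  assumes P: "module K P"
    and h: "is_linear K (tensor_module K M N) P h" and h': "is_linear K (tensor_module K M N) P h'"
    and eq: "\<And>x y. \<lbrakk>x \<in> carrier M; y \<in> carrier N\<rbrakk>
      \<Longrightarrow> h (pure_tensor K M N x y) = h' (pure_tensor K M N x y)"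
    and z: "z \<in> carrier (tensor_group K M N)"
  shows "h z = h' z"
proof -
  interpret P: module K P by fact
  show ?thesis
    by (rule tensor_hom_eqI[OF M N P.add.is_group _ _ _ z])
      (use linear_hom[OF h] linear_hom[OF h'] eq in \<open>simp_all add: hom_def\<close>)
qed

lemma tlift_pure:
  assumes "module K P" "is_bilinear K M N P b" "x \<in> carrier M" "y \<in> carrier N"
  shows "tlift K M N P b (pure_tensor K M N x y) = b x y"
proof -
  interpret P: module K P by fact
  show ?thesis
    by (rule tensor_lift_balanced(3)[OF M N P.add.comm_group_axioms bilinear_balanced]) fact+
qed

lemma tlift_extensional:
  assumes "module K P" "is_bilinear K M N P b"
  shows "tlift K M N P b \<in> extensional (carrier (tensor_group K M N))"
proof -
  interpret P: module K P by fact
  show ?thesis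
    by (rule tensor_lift_balanced(2)[OF M N P.add.comm_group_axioms bilinear_balanced]) fact
qed

text \<open>A lift is a priori only additive. Applying it after scaling and scaling after applying
  it are both additive, and they agree on pure tensors by linearity of \<open>b\<close> in its first
  argument.\<close>

lemma tlift_linear:
  assumes P: "module K P" and b: "is_bilinear K M N P b"
  shows "is_linear K (tensor_module K M N) P (tlift K M N P b)"
proof -
  interpret P: module K P by fact
  let ?l = "tlift K M N P b"
  have hom: "?l \<in> hom (tensor_group K M N) (add_monoid P)"
    by (rule tensor_lift_balanced(1)[OF M N P.add.comm_group_axioms bilinear_balanced[OF b]])
  show ?thesis
  proof (rule is_linearI)
    fix c z assume c: "c \<in> carrier K" and z: "z \<in> carrier (tensor_module K M N)"
    have 1: "(\<lambda>z. ?l (c \<odot>\<^bsub>tensor_module K M N\<^esub> z)) \<in> hom (tensor_group K M N) (add_monoid P)"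
      using Group.hom_compose[OF smult_tensor_hom[OF c] hom] by (simp add: comp_def)
    have 2: "(\<lambda>z. c \<odot>\<^bsub>P\<^esub> ?l z) \<in> hom (tensor_group K M N) (add_monoid P)"
      using Group.hom_compose[OF hom linear_hom[OF smult_linear[OF P c]]] by (simp add: comp_def)
    show "?l (c \<odot>\<^bsub>tensor_module K M N\<^esub> z) = c \<odot>\<^bsub>P\<^esub> ?l z"
      by (rule tensor_hom_eqI[OF M N P.add.is_group 1 2])
        (use c z in \<open>simp_all add: smult_pure_tensor tlift_pure[OF P b] linear_smult[OF bilinear_left[OF b]]\<close>)
  qed (use hom in \<open>auto simp: hom_def Pi_iff\<close>)
qed

text \<open>The rule for moving a linear map inside the sum over a decomposed tensor; both sides are
  linear in \<open>z\<close> and agree on pure tensors.\<close>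

lemma linear_tlift:
  assumes P: "module K P" and Q: "module K Q" and h: "is_linear K P Q h"
    and b: "is_bilinear K M N P b" and z: "z \<in> carrier (tensor_group K M N)"
  shows "h (tlift K M N P b z) = tlift K M N Q (\<lambda>x y. h (b x y)) z"
proof -
  note b' = linear_bilinear[OF h b]
  show ?thesis
    by (rule linear_tensor_eqI[OF Q linear_comp[OF h tlift_linear[OF P b]] tlift_linear[OF Q b'] _ z])
      (simp add: tlift_pure[OF P b] tlift_pure[OF Q b'])
qed

text \<open>Nested decompositions require a lift to depend linearly on an outer variable
  \<open>x\<close>. For fixed \<open>x\<close> everything is linear in the tensor, so sums and
  multiples in \<open>x\<close> can be tested on pure tensors, where they are given by
  \<open>l\<close>.\<close>

lemma tlift_bilinear:
  assumes P: "module K P" and X: "module K X"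
    and b: "\<And>x. x \<in> carrier X \<Longrightarrow> is_bilinear K M N P (b x)"
    and l: "\<And>m n. \<lbrakk>m \<in> carrier M; n \<in> carrier N\<rbrakk> \<Longrightarrow> is_linear K X P (\<lambda>x. b x m n)"
  shows "is_bilinear K X (tensor_module K M N) P (\<lambda>x. tlift K M N P (b x))"
proof (rule bilinearI)
  interpret P: module K P by fact
  interpret X: module K X by fact
  note lin = tlift_linear[OF P b]
  show "is_linear K (tensor_module K M N) P (tlift K M N P (b x))" if "x \<in> carrier X" for x
    by (rule lin[OF that])
  fix z assume "z \<in> carrier (tensor_module K M N)"
  then have z: "z \<in> carrier (tensor_group K M N)" by simp
  show "is_linear K X P (\<lambda>x. tlift K M N P (b x) z)"
  proof (rule is_linearI)
    fix x assume "x \<in> carrier X"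
    then show "tlift K M N P (b x) z \<in> carrier P"
      using linear_closed[OF lin] z by simp
  next
    fix x x' assume x: "x \<in> carrier X" "x' \<in> carrier X"
    have 1: "is_linear K (tensor_module K M N) P (\<lambda>z. tlift K M N P (b x) z \<oplus>\<^bsub>P\<^esub> tlift K M N P (b x') z)"
      using lin[OF x(1)] lin[OF x(2)]
      by (simp add: is_linear_def P.smult_r_distr P.add.m_ac)
    show "tlift K M N P (b (x \<oplus>\<^bsub>X\<^esub> x')) z = tlift K M N P (b x) z \<oplus>\<^bsub>P\<^esub> tlift K M N P (b x') z"
      by (rule linear_tensor_eqI[OF P lin 1 _ z])
        (use x in \<open>simp_all add: tlift_pure[OF P b] linear_add[OF l]\<close>)
  next
    fix c x assume x: "c \<in> carrier K" "x \<in> carrier X"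
    show "tlift K M N P (b (c \<odot>\<^bsub>X\<^esub> x)) z = c \<odot>\<^bsub>P\<^esub> tlift K M N P (b x) z"
      by (rule linear_tensor_eqI[OF P lin linear_comp[OF smult_linear[OF P x(1)] lin] _ z])
        (use x in \<open>simp_all add: tlift_pure[OF P b] linear_smult[OF l]\<close>)
  qed
qed

end

section \<open>Tensor products of linear maps\<close>

lemma tensor_map_tlift:
  "tensor_map K M N P Q f h = tlift K M N (tensor_module K P Q) (\<lambda>x y. pure_tensor K P Q (f x) (h y))"
  by (simp add: tensor_map_def tensor_lift_tensor_group)

text \<open>Allows the factor maps to be rewritten on carriers only, which is where the laws of
  algebras and bimodules hold.\<close>

lemma tensor_map_cong:
  assumes "\<And>x. x \<in> carrier M \<Longrightarrow> f x = f' x" "\<And>y. y \<in> carrier N \<Longrightarrow> h y = h' y"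
  shows "tensor_map K M N P Q f h = tensor_map K M N P Q f' h'"
  unfolding tensor_map_def by (rule tensor_lift_cong) (simp add: assms)

context
  fixes K :: "('k, 'r) ring_scheme" and M :: "('k, 'm, 's) module_scheme"
    and N :: "('k, 'n, 't) module_scheme" and P :: "('k, 'p, 'u) module_scheme"
    and Q :: "('k, 'q, 'w) module_scheme" and f h
  assumes M: "module K M" and N: "module K N" and P: "module K P" and Q: "module K Q"
    and f: "is_linear K M P f" and h: "is_linear K N Q h"
begin

lemma tensor_map_bilinear:
  "is_bilinear K M N (tensor_module K P Q) (\<lambda>x y. pure_tensor K P Q (f x) (h y))"
  by (rule bilinear_comp[OF pure_tensor_bilinear[OF P Q] f h])

lemma tensor_map_linear:
  "is_linear K (tensor_module K M N) (tensor_module K P Q) (tensor_map K M N P Q f h)"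
  unfolding tensor_map_tlift
  by (rule tlift_linear[OF M N tensor_module_module[OF P Q] tensor_map_bilinear])

lemma tensor_map_pure:
  "\<lbrakk>x \<in> carrier M; y \<in> carrier N\<rbrakk>
    \<Longrightarrow> tensor_map K M N P Q f h (pure_tensor K M N x y) = pure_tensor K P Q (f x) (h y)"
  unfolding tensor_map_tlift
  by (rule tlift_pure[OF M N tensor_module_module[OF P Q] tensor_map_bilinear])

text \<open>The substitution rule for decompositions: \<open>linear_tlift\<close> moves the outer
  lift inside, where it meets a pure tensor and can be evaluated.\<close>

lemma tlift_tensor_map:
  assumes R: "module K R" and b: "is_bilinear K P Q R b" and z: "z \<in> carrier (tensor_group K M N)"
  shows "tlift K P Q R b (tensor_map K M N P Q f h z) = tlift K M N R (\<lambda>x y. b (f x) (h y)) z"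
proof -
  have "tlift K P Q R b (tensor_map K M N P Q f h z)
      = tlift K M N R (\<lambda>x y. tlift K P Q R b (pure_tensor K P Q (f x) (h y))) z"
    unfolding tensor_map_tlift
    by (rule linear_tlift[OF M N tensor_module_module[OF P Q] R tlift_linear[OF P Q R b] tensor_map_bilinear z])
  also have "\<dots> = tlift K M N R (\<lambda>x y. b (f x) (h y)) z"
    by (rule fun_cong[OF tensor_lift_cong], rule tlift_pure[OF P Q R b])
      (simp_all add: linear_closed[OF f] linear_closed[OF h])
  finally show ?thesis .
qed

end

lemma tensor_map_comp:
  assumes M: "module K M" and N: "module K N" and P: "module K P" and Q: "module K Q"
    and M': "module K M'" and N': "module K N'"
    and f: "is_linear K M P f" and h: "is_linear K N Q h"
    and f': "is_linear K P M' f'" and h': "is_linear K Q N' h'"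
    and z: "z \<in> carrier (tensor_group K M N)"
  shows "tensor_map K P Q M' N' f' h' (tensor_map K M N P Q f h z)
      = tensor_map K M N M' N' (\<lambda>x. f' (f x)) (\<lambda>y. h' (h y)) z"
  unfolding tensor_map_tlift[of K P] tensor_map_tlift[of K M N M']
  by (rule tlift_tensor_map[OF M N P Q f h tensor_module_module[OF M' N']
        tensor_map_bilinear[OF P Q M' N' f' h'] z])

lemma tensor_map_ident:
  assumes M: "module K M" and N: "module K N" and z: "z \<in> carrier (tensor_group K M N)"
  shows "tensor_map K M N M N (\<lambda>x. x) (\<lambda>y. y) z = z"
  by (rule linear_tensor_eqI[OF M N tensor_module_module[OF M N]
        tensor_map_linear[OF M N M N linear_ident linear_ident] linear_ident _ z])
    (simp add: tensor_map_pure[OF M N M N linear_ident linear_ident])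

section \<open>Trilinear maps and triple tensor products\<close>

definition is_trilinear :: "('k, 'r) ring_scheme \<Rightarrow> ('k, 'l, 's) module_scheme
    \<Rightarrow> ('k, 'm, 't) module_scheme \<Rightarrow> ('k, 'n, 'u) module_scheme \<Rightarrow> ('k, 'p, 'w) module_scheme
    \<Rightarrow> ('l \<Rightarrow> 'm \<Rightarrow> 'n \<Rightarrow> 'p) \<Rightarrow> bool"
  where "is_trilinear K L M N P b \<longleftrightarrow>
    (\<forall>y\<in>carrier M. \<forall>z\<in>carrier N. is_linear K L P (\<lambda>x. b x y z)) \<and>
    (\<forall>x\<in>carrier L. \<forall>z\<in>carrier N. is_linear K M P (\<lambda>y. b x y z)) \<and>
    (\<forall>x\<in>carrier L. \<forall>y\<in>carrier M. is_linear K N P (b x y))"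

lemma trilinear_of_bilinear:
  assumes "is_bilinear K L Q P B" "is_bilinear K M N Q c"
  shows "is_trilinear K L M N P (\<lambda>x y z. B x (c y z))"
  using assms by (simp add: is_trilinear_def is_bilinear_def is_linear_def)

text \<open>Stating trilinearity one argument at a time makes permutations immediate. The three
  descent maps leave the first, the middle or the last factor of the target untouched, and that
  factor must come to the front before \<open>tlift_trilinear\<close> applies.\<close>

lemma trilinear_swap: "is_trilinear K L M N P b \<Longrightarrow> is_trilinear K M L N P (\<lambda>y x z. b x y z)"
  by (simp add: is_trilinear_def)

lemma trilinear_rotate: "is_trilinear K L M N P b \<Longrightarrow> is_trilinear K N L M P (\<lambda>z x y. b x y z)"
  by (simp add: is_trilinear_def)

lemma trilinear_rotate': "is_trilinear K L M N P b \<Longrightarrow> is_trilinear K M N L P (\<lambda>y z x. b x y z)"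
  by (simp add: is_trilinear_def)

lemma trilinear_bilinear:
  "\<lbrakk>is_trilinear K L M N P b; x \<in> carrier L\<rbrakk> \<Longrightarrow> is_bilinear K M N P (b x)"
  by (simp add: is_trilinear_def is_bilinear_def)

lemma tlift_trilinear:
  assumes "module K M" "module K N" "module K P" "module K L" and b: "is_trilinear K L M N P b"
  shows "is_bilinear K L (tensor_module K M N) P (\<lambda>x. tlift K M N P (b x))"
  by (rule tlift_bilinear[OF assms(1-4) trilinear_bilinear[OF b]])
    (use b in \<open>simp_all add: is_trilinear_def\<close>)

lemma tensor3_lift_tlift:
  "tensor3_lift K L M N (tensor3_group K P Q R) b
    = tlift K L (tensor_module K M N) (tensor_module K P (tensor_module K Q R))
        (\<lambda>x. tlift K M N (tensor_module K P (tensor_module K Q R)) (b x))"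
  by (simp add: tensor3_lift_def tensor_lift_tensor3_group)

context
  fixes K :: "('k, 'r) ring_scheme" and L :: "('k, 'l, 's) module_scheme"
    and M :: "('k, 'm, 't) module_scheme" and N :: "('k, 'n, 'u) module_scheme"
  assumes L: "module K L" and M: "module K M" and N: "module K N"
begin

lemma tensor3_module: "module K (tensor_module K L (tensor_module K M N))"
  by (rule tensor_module_module[OF L tensor_module_module[OF M N]])

lemma pure_tensor3_trilinear:
  "is_trilinear K L M N (tensor_module K L (tensor_module K M N)) (pure_tensor3 K L M N)"
  unfolding pure_tensor3_def
  by (rule trilinear_of_bilinear[OF pure_tensor_bilinear[OF L tensor_module_module[OF M N]]
        pure_tensor_bilinear[OF M N]])

lemma tensor3_tlift_linear:
  assumes P: "module K P" and b: "is_trilinear K L M N P b"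
  shows "is_linear K (tensor_module K L (tensor_module K M N)) P
    (tlift K L (tensor_module K M N) P (\<lambda>x. tlift K M N P (b x)))"
  by (rule tlift_linear[OF L tensor_module_module[OF M N] P tlift_trilinear[OF M N P L b]])

lemma tensor3_tlift_pure:
  assumes P: "module K P" and b: "is_trilinear K L M N P b"
    and "x \<in> carrier L" "y \<in> carrier M" "z \<in> carrier N"
  shows "tlift K L (tensor_module K M N) P (\<lambda>x. tlift K M N P (b x)) (pure_tensor3 K L M N x y z) = b x y z"
  using assms pure_tensor_closed[OF M N]
  by (simp add: pure_tensor3_def tlift_pure[OF L tensor_module_module[OF M N] P tlift_trilinear[OF M N P L b]]
      tlift_pure[OF M N P trilinear_bilinear[OF b]])

text \<open>The triple product is nested: the first reduction is to outer tensors of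
  \<open>x\<close> with some \<open>u\<close>, and for fixed \<open>x\<close> both sides are linear
  in \<open>u\<close>, which permits a second reduction.\<close>

lemma linear_tensor3_eqI:
  assumes P: "module K P"
    and h: "is_linear K (tensor_module K L (tensor_module K M N)) P h"
    and h': "is_linear K (tensor_module K L (tensor_module K M N)) P h'"
    and eq: "\<And>x y z. \<lbrakk>x \<in> carrier L; y \<in> carrier M; z \<in> carrier N\<rbrakk>
      \<Longrightarrow> h (pure_tensor3 K L M N x y z) = h' (pure_tensor3 K L M N x y z)"
    and t: "t \<in> carrier (tensor3_group K L M N)"
  shows "h t = h' t"
proof (rule linear_tensor_eqI[OF L tensor_module_module[OF M N] P h h'])
  note pure = pure_tensor_bilinear[OF L tensor_module_module[OF M N]]
  fix x u assume x: "x \<in> carrier L" and "u \<in> carrier (tensor_module K M N)"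
  then have u: "u \<in> carrier (tensor_group K M N)" by simp
  note lin = bilinear_right[OF linear_bilinear[OF h pure] x] bilinear_right[OF linear_bilinear[OF h' pure] x]
  show "h (pure_tensor K L (tensor_module K M N) x u) = h' (pure_tensor K L (tensor_module K M N) x u)"
    by (rule linear_tensor_eqI[OF M N P lin _ u]) (use eq x in \<open>simp add: pure_tensor3_def\<close>)
qed (use t in \<open>simp add: tensor3_group_def\<close>)

end

section \<open>Bilinearity of the actions and the regular bimodule\<close>

lemma (in assoc_algebra) mult_bilinear: "is_bilinear K A A A (monoid.mult A)"
  by (intro bilinearI is_linearI)
    (simp_all add: smult_mult_left smult_mult_right l_distr r_distr)

context bimodule
begin

lemma module_A: "module K A" by unfold_locales
lemma module_V: "module K V" by unfold_locales

text \<open>Scalars act through \<open>c1\<close>, so homogeneity in the first argument is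
  associativity of the action. For the second argument, \<open>c1\<close> is moved past
  \<open>a\<close>, using that scalars are central in \<open>A\<close>.\<close>

lemma lact_bilinear: "is_bilinear K A V V (lact V)"
proof (intro bilinearI is_linearI)
  fix a c v assume c: "a \<in> carrier A" "c \<in> carrier K" "v \<in> carrier V"
  have "lact V (c \<odot>\<^bsub>A\<^esub> a) v = lact V ((c \<odot>\<^bsub>A\<^esub> \<one>\<^bsub>A\<^esub>) \<otimes>\<^bsub>A\<^esub> a) v"
    using c by (simp add: smult_mult_left)
  also have "\<dots> = c \<odot>\<^bsub>V\<^esub> lact V a v"
    using c by (simp add: mult_lact lact_central lact_closed del: smult_mult_left)
  finally show 1: "lact V (c \<odot>\<^bsub>A\<^esub> a) v = c \<odot>\<^bsub>V\<^esub> lact V a v" .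
  have "lact V a (c \<odot>\<^bsub>V\<^esub> v) = lact V (a \<otimes>\<^bsub>A\<^esub> (c \<odot>\<^bsub>A\<^esub> \<one>\<^bsub>A\<^esub>)) v"
    using c by (simp add: mult_lact lact_central del: smult_mult_right)
  also have "\<dots> = lact V (c \<odot>\<^bsub>A\<^esub> a) v"
    using c by (simp add: smult_mult_right)
  finally show "lact V a (c \<odot>\<^bsub>V\<^esub> v) = c \<odot>\<^bsub>V\<^esub> lact V a v" using 1 by simp
qed (simp_all add: lact_closed lact_add add_lact)

lemma ract_bilinear: "is_bilinear K V A V (ract V)"
proof (intro bilinearI is_linearI)
  fix a c v assume c: "a \<in> carrier A" "c \<in> carrier K" "v \<in> carrier V"
  have "ract V v (c \<odot>\<^bsub>A\<^esub> a) = ract V v (a \<otimes>\<^bsub>A\<^esub> (c \<odot>\<^bsub>A\<^esub> \<one>\<^bsub>A\<^esub>))"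
    using c by (simp add: smult_mult_right)
  also have "\<dots> = c \<odot>\<^bsub>V\<^esub> ract V v a"
    using c by (simp add: mult_ract ract_central ract_closed del: smult_mult_right)
  finally show 1: "ract V v (c \<odot>\<^bsub>A\<^esub> a) = c \<odot>\<^bsub>V\<^esub> ract V v a" .
  have "ract V (c \<odot>\<^bsub>V\<^esub> v) a = ract V v ((c \<odot>\<^bsub>A\<^esub> \<one>\<^bsub>A\<^esub>) \<otimes>\<^bsub>A\<^esub> a)"
    using c by (simp add: mult_ract ract_central del: smult_mult_left)
  also have "\<dots> = ract V v (c \<odot>\<^bsub>A\<^esub> a)"
    using c by (simp add: smult_mult_left)
  finally show "ract V (c \<odot>\<^bsub>V\<^esub> v) a = c \<odot>\<^bsub>V\<^esub> ract V v a" using 1 by simp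
qed (simp_all add: ract_closed ract_add add_ract)

lemmas lact_linear = bilinear_right[OF lact_bilinear]
lemmas ract_linear = bilinear_left[OF ract_bilinear]

end

lemma (in assoc_algebra) regular_bimodule_bimodule: "bimodule K A (regular_bimodule A)"
proof -
  interpret R: module K "regular_bimodule A"
    by (rule moduleI)
      (auto intro!: abelian_groupI R.is_cring
        simp: regular_bimodule_def smult_l_distr smult_r_distr smult_assoc1 M.a_assoc M.a_comm M.a_lcomm M.add.l_inv_ex)
  show ?thesis
    by unfold_locales
      (simp_all add: regular_bimodule_def l_distr r_distr m_assoc smult_mult_left smult_mult_right)
qed

lemma regular_bimodule_sel [simp]:
  "carrier (regular_bimodule A) = carrier A"
  "lact (regular_bimodule A) = monoid.mult A"
  "ract (regular_bimodule A) = monoid.mult A"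
  "smult (regular_bimodule A) = smult A"
  "add (regular_bimodule A) = add A"
  by (simp_all add: regular_bimodule_def)

text \<open>\<open>regular_bimodule A\<close> and \<open>A\<close> are different records with the
  same carrier, addition and scalars, and these are all that the tensor constructions inspect.
  Factorwise actions need the former, while descent maps are written with the latter.\<close>

lemma regular_bimodule_tensor [simp]:
  "tensor_group K (regular_bimodule A) V = tensor_group K A V"
  "tensor_group K V (regular_bimodule A) = tensor_group K V A"
  "pure_tensor K (regular_bimodule A) V = pure_tensor K A V"
  "pure_tensor K V (regular_bimodule A) = pure_tensor K V A"
  by (simp_all add: tensor_group_def tensor_subgroup_def tensor_relators_def pure_tensor_def fun_eq_iff)

lemma regular_bimodule_tensor_lift [simp]:
  "tensor_lift K (regular_bimodule A) V = tensor_lift K A V"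
  "tensor_lift K V (regular_bimodule A) = tensor_lift K V A"
  by (simp_all add: tensor_lift_def fun_eq_iff)

lemma regular_bimodule_tensor_module [simp]:
  "tensor_module K (regular_bimodule A) V = tensor_module K A V"
  "tensor_module K V (regular_bimodule A) = tensor_module K V A"
  "tensor_map K (regular_bimodule A) V P Q = tensor_map K A V P Q"
  "tensor_map K V (regular_bimodule A) P Q = tensor_map K V A P Q"
  "tensor_map K P Q (regular_bimodule A) V = tensor_map K P Q A V"
  "tensor_map K P Q V (regular_bimodule A) = tensor_map K P Q V A"
  by (simp_all add: tensor_module_def tensor_map_def fun_eq_iff)

section \<open>The factorwise bimodule structure on a tensor product\<close>

lemma tensor_bimodule_sel [simp]:
  "carrier (tensor_bimodule K A B M N) = carrier (tensor_group K M N)"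
  "add (tensor_bimodule K A B M N) = monoid.mult (tensor_group K M N)"
  by (simp_all add: tensor_bimodule_def)

context
  fixes K :: "('k, 'r) ring_scheme" and A :: "('k, 'a, 's) module_scheme"
    and B :: "('k, 'b, 't) module_scheme" and M :: "('k, 'a, 'm, 'u) bimod_scheme"
    and N :: "('k, 'b, 'n, 'w) bimod_scheme"
  assumes M: "bimodule K A M" and N: "bimodule K B N"
begin

interpretation M: bimodule K A M by (rule M)
interpretation N: bimodule K B N by (rule N)

lemmas modules = M.module_V N.module_V

text \<open>\<open>f\<close> and \<open>h\<close> stand for left actions, or for right actions with
  flipped arguments, so both sides of the bimodule structure are covered at once.\<close>

lemma tensor_map_trilinear:
  assumes f: "is_bilinear K A M M f" and h: "is_bilinear K B N N h"
  shows "is_trilinear K (tensor_module K M N) A B (tensor_module K M N)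
    (\<lambda>z a b. tensor_map K M N M N (f a) (h b) z)"
proof -
  let ?T = "tensor_module K M N"
  note T = tensor_module_module[OF modules]
  note pure = pure_tensor_bilinear[OF modules]
  have fl: "is_linear K M M (f a)" if "a \<in> carrier A" for a
    using bilinear_right[OF f that] .
  have hl: "is_linear K N N (h b)" if "b \<in> carrier B" for b
    using bilinear_right[OF h that] .
  have 1: "is_linear K A ?T (\<lambda>a. tensor_map K M N M N (f a) (h b) z)"
    if b: "b \<in> carrier B" and z: "z \<in> carrier ?T" for b z
    unfolding tensor_map_tlift
    by (rule bilinear_left[OF tlift_bilinear[OF modules T M.module_A] z])
      (use b in \<open>auto intro!: tensor_map_bilinear[OF modules modules] fl hl
          linear_comp[OF bilinear_left[OF pure] bilinear_left[OF f]] linear_closed[OF hl]\<close>)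
  have 2: "is_linear K B ?T (\<lambda>b. tensor_map K M N M N (f a) (h b) z)"
    if a: "a \<in> carrier A" and z: "z \<in> carrier ?T" for a z
    unfolding tensor_map_tlift
    by (rule bilinear_left[OF tlift_bilinear[OF modules T N.module_A] z])
      (use a in \<open>auto intro!: tensor_map_bilinear[OF modules modules] fl hl
          linear_comp[OF bilinear_right[OF pure] bilinear_left[OF h]] linear_closed[OF fl]\<close>)
  show ?thesis
    using 1 2 tensor_map_linear[OF modules modules fl hl] by (simp add: is_trilinear_def)
qed

lemma tensor_lact_bilinear:
  "is_bilinear K (tensor_module K A B) (tensor_module K M N) (tensor_module K M N)
     (lact (tensor_bimodule K A B M N))"
  using bilinear_flip[OF tlift_trilinear[OF M.module_A N.module_A tensor_module_module[OF modules]
      tensor_module_module[OF modules] tensor_map_trilinear[OF M.lact_bilinear N.lact_bilinear]]]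
  by (simp add: tensor_bimodule_def tensor_lift_tensor_group)

lemma tensor_ract_bilinear:
  "is_bilinear K (tensor_module K M N) (tensor_module K A B) (tensor_module K M N)
     (ract (tensor_bimodule K A B M N))"
  using tlift_trilinear[OF M.module_A N.module_A tensor_module_module[OF modules]
      tensor_module_module[OF modules]
      tensor_map_trilinear[OF bilinear_flip[OF M.ract_bilinear] bilinear_flip[OF N.ract_bilinear]]]
  by (simp add: tensor_bimodule_def tensor_lift_tensor_group)

lemma tensor_lact_pure:
  assumes "a \<in> carrier A" "b \<in> carrier B" "z \<in> carrier (tensor_group K M N)"
  shows "lact (tensor_bimodule K A B M N) (pure_tensor K A B a b) z
    = tensor_map K M N M N (lact M a) (lact N b) z"
  using assms tlift_pure[OF M.module_A N.module_A tensor_module_module[OF modules]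
      trilinear_bilinear[OF tensor_map_trilinear[OF M.lact_bilinear N.lact_bilinear]]]
  by (simp add: tensor_bimodule_def tensor_lift_tensor_group)

lemma tensor_ract_pure:
  assumes "a \<in> carrier A" "b \<in> carrier B" "z \<in> carrier (tensor_group K M N)"
  shows "ract (tensor_bimodule K A B M N) z (pure_tensor K A B a b)
    = tensor_map K M N M N (\<lambda>x. ract M x a) (\<lambda>y. ract N y b) z"
  using assms tlift_pure[OF M.module_A N.module_A tensor_module_module[OF modules]
      trilinear_bilinear[OF tensor_map_trilinear[OF bilinear_flip[OF M.ract_bilinear]
          bilinear_flip[OF N.ract_bilinear]]]]
  by (simp add: tensor_bimodule_def tensor_lift_tensor_group)

lemma tensor_lact_pure_pure:
  assumes "a \<in> carrier A" "b \<in> carrier B" "x \<in> carrier M" "y \<in> carrier N"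
  shows "lact (tensor_bimodule K A B M N) (pure_tensor K A B a b) (pure_tensor K M N x y)
    = pure_tensor K M N (lact M a x) (lact N b y)"
  using assms
  by (simp add: tensor_lact_pure pure_tensor_closed[OF modules] M.lact_linear N.lact_linear
      tensor_map_pure[OF modules modules])

lemma tensor_ract_pure_pure:
  assumes "a \<in> carrier A" "b \<in> carrier B" "x \<in> carrier M" "y \<in> carrier N"
  shows "ract (tensor_bimodule K A B M N) (pure_tensor K M N x y) (pure_tensor K A B a b)
    = pure_tensor K M N (ract M x a) (ract N y b)"
  using assms
  by (simp add: tensor_ract_pure pure_tensor_closed[OF modules] M.ract_linear N.ract_linear
      tensor_map_pure[OF modules modules])

text \<open>On pure tensors this is centrality of \<open>M\<close>. It is the source of
  \<open>K\<close>-linearity for descent maps, whose definition mentions only addition and the two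
  actions.\<close>

lemma tensor_lact_central:
  assumes c: "c \<in> carrier K" and z: "z \<in> carrier (tensor_group K M N)"
  shows "lact (tensor_bimodule K A B M N) (pure_tensor K A B (c \<odot>\<^bsub>A\<^esub> \<one>\<^bsub>A\<^esub>) \<one>\<^bsub>B\<^esub>) z
    = c \<odot>\<^bsub>tensor_module K M N\<^esub> z"
proof -
  have p: "pure_tensor K A B (c \<odot>\<^bsub>A\<^esub> \<one>\<^bsub>A\<^esub>) \<one>\<^bsub>B\<^esub> \<in> carrier (tensor_module K A B)"
    using c by (simp add: pure_tensor_closed[OF M.module_A N.module_A])
  show ?thesis
    by (rule linear_tensor_eqI[OF modules tensor_module_module[OF modules]
          bilinear_right[OF tensor_lact_bilinear p] smult_linear[OF tensor_module_module[OF modules] c] _ z])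
      (use c in \<open>simp add: tensor_lact_pure_pure M.lact_central N.one_lact smult_pure_tensor[OF modules]\<close>)
qed

end

section \<open>Descent data and coactions\<close>

lemma is_yetter_drinfeld_iff:
  "is_yetter_drinfeld K A V \<rho> \<longleftrightarrow>
    \<rho> \<in> linear_maps K V (tensor_module K V A) \<and>
    (\<forall>v\<in>carrier V. tlift K V A V (ract V) (\<rho> v) = v) \<and>
    (\<forall>v\<in>carrier V.
       tlift K V A (tensor_module K V (tensor_module K A A))
         (\<lambda>v0 v1. tlift K V A (tensor_module K V (tensor_module K A A))
            (\<lambda>w0 w1. pure_tensor3 K V A A w0 w1 v1) (\<rho> v0)) (\<rho> v)
       = tlift K V A (tensor_module K V (tensor_module K A A))
           (\<lambda>v0 v1. pure_tensor3 K V A A v0 \<one>\<^bsub>A\<^esub> v1) (\<rho> v)) \<and>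
    (\<forall>v\<in>carrier V. \<forall>a\<in>carrier A.
       \<rho> (ract V v a) = tensor_map K V A V A (\<lambda>x. x) (\<lambda>y. y \<otimes>\<^bsub>A\<^esub> a) (\<rho> v)) \<and>
    (\<forall>v\<in>carrier V. \<forall>a\<in>carrier A.
       \<rho> (lact V a v) = tensor_map K V A V A (\<lambda>x. x) (\<lambda>y. a \<otimes>\<^bsub>A\<^esub> y) (\<rho> v)) \<and>
    (\<forall>v\<in>carrier V. \<forall>a\<in>carrier A.
       tensor_map K V A V A (lact V a) (\<lambda>y. y) (\<rho> v)
       = tensor_map K V A V A (\<lambda>x. ract V x a) (\<lambda>y. y) (\<rho> v))"
  by (simp add: is_yetter_drinfeld_def tensor_map_def tensor_lift_tensor3_group)

text \<open>The left action of \<open>a\<close> is chosen here; the last Yetter-Drinfeld condition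
  says that the right action would give the same map.\<close>

definition descent_of :: "('k, 'r) ring_scheme \<Rightarrow> ('k, 'a, 's) module_scheme
    \<Rightarrow> ('k, 'a, 'v) bimod \<Rightarrow> ('v \<Rightarrow> ('v, 'a) tensor) \<Rightarrow> ('a, 'v) tensor \<Rightarrow> ('v, 'a) tensor"
  where "descent_of K A V \<rho> = tlift K A V (tensor_module K V A)
    (\<lambda>a v. tensor_map K V A V A (lact V a) (\<lambda>y. y) (\<rho> v))"

definition coaction_of :: "('k, 'r) ring_scheme \<Rightarrow> ('k, 'a, 's) module_scheme
    \<Rightarrow> ('k, 'a, 'v) bimod \<Rightarrow> (('a, 'v) tensor \<Rightarrow> ('v, 'a) tensor) \<Rightarrow> 'v \<Rightarrow> ('v, 'a) tensor"
  where "coaction_of K A V g = (\<lambda>v\<in>carrier V. g (pure_tensor K A V \<one>\<^bsub>A\<^esub> v))"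

text \<open>Specializes \<open>bimodule\<close> to plain \<open>bimod\<close> records, the type for
  which descent data and coactions are defined.\<close>

locale bimodule_over = bimodule K A V
  for K :: "('k, 'r) ring_scheme" (structure) and A :: "('k, 'a, 's) module_scheme" (structure)
    and V :: "('k, 'a, 'v) bimod"
begin

abbreviation "AV \<equiv> tensor_module K A V"
abbreviation "VA \<equiv> tensor_module K V A"
abbreviation "VAA \<equiv> tensor_module K V (tensor_module K A A)"
abbreviation "AVA \<equiv> tensor_module K A (tensor_module K V A)"
abbreviation "AAV \<equiv> tensor_module K A (tensor_module K A V)"
abbreviation "act f h \<equiv> tensor_map K V A V A f h"

lemmas module_VA = tensor_module_module[OF module_V module_A]
lemmas module_AV = tensor_module_module[OF module_A module_V]
lemmas module_VAA = tensor3_module[OF module_V module_A module_A]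
lemmas module_AVA = tensor3_module[OF module_A module_V module_A]
lemmas left_mult_linear = bilinear_right[OF mult_bilinear]
lemmas right_mult_linear = bilinear_left[OF mult_bilinear]
lemmas act_comp = tensor_map_comp[OF module_V module_A module_V module_A module_V module_A]
lemmas pure_VAA_trilinear = pure_tensor3_trilinear[OF module_V module_A module_A]
lemmas pure_AVA_trilinear = pure_tensor3_trilinear[OF module_A module_V module_A]

lemma lact_one_tensor:
  "z \<in> carrier (tensor_group K V A) \<Longrightarrow> act (lact V \<one>\<^bsub>A\<^esub>) (\<lambda>y. y) z = z"
  by (rule trans[OF fun_cong[OF tensor_map_cong] tensor_map_ident[OF module_V module_A]]) (simp_all add: one_lact)

text \<open>By \<open>tlift_bilinear\<close>, letting \<open>a\<close> act on the first factor is
  bilinear in \<open>a\<close> and in the tensor acted upon; the linear map \<open>\<rho>\<close> is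
  then substituted for the latter.\<close>

lemma descent_bilinear:
  assumes \<rho>: "is_linear K V VA \<rho>"
  shows "is_bilinear K A V VA (\<lambda>a v. act (lact V a) (\<lambda>y. y) (\<rho> v))"
proof -
  have "is_bilinear K A VA VA (\<lambda>a. act (lact V a) (\<lambda>y. y))"
    unfolding tensor_map_tlift
  proof (rule tlift_bilinear[OF module_V module_A module_VA module_A])
    fix a assume "a \<in> carrier A"
    then show "is_bilinear K V A VA (\<lambda>x y. pure_tensor K V A (lact V a x) y)"
      by (rule tensor_map_bilinear[OF module_V module_A module_V module_A lact_linear linear_ident])
  next
    fix v y assume "v \<in> carrier V" "y \<in> carrier A"
    then show "is_linear K A VA (\<lambda>a. pure_tensor K V A (lact V a v) y)"
      by (intro linear_comp[OF bilinear_left[OF pure_tensor_bilinear[OF module_V module_A]] bilinear_left[OF lact_bilinear]])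
  qed
  from bilinear_comp[OF this linear_ident \<rho>] show ?thesis .
qed

lemma descent_of_pure:
  assumes \<rho>: "is_linear K V VA \<rho>" and "a \<in> carrier A" "v \<in> carrier V"
  shows "descent_of K A V \<rho> (pure_tensor K A V a v) = act (lact V a) (\<lambda>y. y) (\<rho> v)"
  unfolding descent_of_def by (rule tlift_pure[OF module_A module_V module_VA descent_bilinear[OF \<rho>]]) fact+

lemma descent_of_linear:
  assumes \<rho>: "is_linear K V VA \<rho>"
  shows "is_linear K AV VA (descent_of K A V \<rho>)"
  unfolding descent_of_def by (rule tlift_linear[OF module_A module_V module_VA descent_bilinear[OF \<rho>]])

lemma descent_of_extensional:
  assumes \<rho>: "is_linear K V VA \<rho>"
  shows "descent_of K A V \<rho> \<in> extensional (carrier (tensor_group K A V))"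
  unfolding descent_of_def by (rule tlift_extensional[OF module_A module_V module_VA descent_bilinear[OF \<rho>]])

section \<open>The cocycle condition expressed through the coaction\<close>

context
  fixes \<rho> :: "'v \<Rightarrow> ('v, 'a) tensor"
  assumes \<rho>: "is_linear K V VA \<rho>"
    and left: "\<And>a v. \<lbrakk>a \<in> carrier A; v \<in> carrier V\<rbrakk>
      \<Longrightarrow> \<rho> (lact V a v) = act (\<lambda>x. x) (\<lambda>y. a \<otimes>\<^bsub>A\<^esub> y) (\<rho> v)"
begin

private abbreviation "g \<equiv> descent_of K A V \<rho>"

lemma coaction_closed: "v \<in> carrier V \<Longrightarrow> \<rho> v \<in> carrier (tensor_group K V A)"
  using linear_closed[OF \<rho>] by simp

lemma g_pure_bilinear: "is_bilinear K A V VA (\<lambda>a v. g (pure_tensor K A V a v))"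
  by (rule linear_bilinear[OF descent_of_linear[OF \<rho>] pure_tensor_bilinear[OF module_A module_V]])

text \<open>Eliminates decompositions of \<open>g (a \<otimes> v)\<close> in favour of
  decompositions of \<open>\<rho> v\<close>, by the substitution rule
  \<open>tlift_tensor_map\<close>.\<close>

lemma lift_g_pure:
  assumes P: "module K P" and b: "is_bilinear K V A P b" and c: "a \<in> carrier A" "v \<in> carrier V"
  shows "tlift K V A P b (g (pure_tensor K A V a v)) = tlift K V A P (\<lambda>w x. b (lact V a w) x) (\<rho> v)"
  using c by (simp add: descent_of_pure[OF \<rho>]
      tlift_tensor_map[OF module_V module_A module_V module_A lact_linear linear_ident P b coaction_closed])

lemma descent_map1_trilinear:
  "is_trilinear K A A V AVA (\<lambda>b a v. tlift K V A AVA (\<lambda>w x. pure_tensor3 K A V A b w x) (g (pure_tensor K A V a v)))"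
  by (rule trilinear_of_bilinear[OF tlift_trilinear[OF module_V module_A module_AVA module_A pure_AVA_trilinear] g_pure_bilinear])

lemma descent_map2_trilinear:
  "is_trilinear K A A V VAA (\<lambda>a b v. tlift K V A VAA (\<lambda>w x. pure_tensor3 K V A A w b x) (g (pure_tensor K A V a v)))"
  by (rule trilinear_swap[OF trilinear_of_bilinear[OF
          tlift_trilinear[OF module_V module_A module_VAA module_A trilinear_swap[OF pure_VAA_trilinear]] g_pure_bilinear]])

lemma descent_map3_trilinear:
  "is_trilinear K A V A VAA (\<lambda>a v b. tlift K V A VAA (\<lambda>w x. pure_tensor3 K V A A w x b) (g (pure_tensor K A V a v)))"
  by (rule trilinear_rotate'[OF trilinear_of_bilinear[OF
          tlift_trilinear[OF module_V module_A module_VAA module_A trilinear_rotate[OF pure_VAA_trilinear]] g_pure_bilinear]])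

private abbreviation "m1 \<equiv> descent_map1 K A V g"
private abbreviation "m2 \<equiv> descent_map2 K A V g"
private abbreviation "m3 \<equiv> descent_map3 K A V g"

lemma descent_map1_linear: "is_linear K AAV AVA m1"
  unfolding descent_map1_def tensor3_lift_tlift tensor_lift_tensor3_group
  by (rule tensor3_tlift_linear[OF module_A module_A module_V module_AVA descent_map1_trilinear])

lemma descent_map2_linear: "is_linear K AAV VAA m2"
  unfolding descent_map2_def tensor3_lift_tlift tensor_lift_tensor3_group
  by (rule tensor3_tlift_linear[OF module_A module_A module_V module_VAA descent_map2_trilinear])

lemma descent_map3_linear: "is_linear K AVA VAA m3"
  unfolding descent_map3_def tensor3_lift_tlift tensor_lift_tensor3_group
  by (rule tensor3_tlift_linear[OF module_A module_V module_A module_VAA descent_map3_trilinear])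

lemma descent_map1_pure:
  assumes "a \<in> carrier A" "b \<in> carrier A" "v \<in> carrier V"
  shows "m1 (pure_tensor3 K A A V a b v) = tlift K V A AVA (\<lambda>w x. pure_tensor3 K A V A a (lact V b w) x) (\<rho> v)"
  unfolding descent_map1_def tensor3_lift_tlift tensor_lift_tensor3_group
  by (rule trans[OF tensor3_tlift_pure[OF module_A module_A module_V module_AVA descent_map1_trilinear]
        lift_g_pure[OF module_AVA trilinear_bilinear[OF pure_AVA_trilinear]]]) fact+

lemma descent_map2_pure:
  assumes "a \<in> carrier A" "b \<in> carrier A" "v \<in> carrier V"
  shows "m2 (pure_tensor3 K A A V a b v) = tlift K V A VAA (\<lambda>w x. pure_tensor3 K V A A (lact V a w) b x) (\<rho> v)"
  unfolding descent_map2_def tensor3_lift_tlift tensor_lift_tensor3_group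
  by (rule trans[OF tensor3_tlift_pure[OF module_A module_A module_V module_VAA descent_map2_trilinear]
        lift_g_pure[OF module_VAA trilinear_bilinear[OF trilinear_swap[OF pure_VAA_trilinear]]]]) fact+

lemma descent_map3_pure:
  assumes "a \<in> carrier A" "v \<in> carrier V" "b \<in> carrier A"
  shows "m3 (pure_tensor3 K A V A a v b) = tlift K V A VAA (\<lambda>w x. pure_tensor3 K V A A (lact V a w) x b) (\<rho> v)"
  unfolding descent_map3_def tensor3_lift_tlift tensor_lift_tensor3_group
  by (rule trans[OF tensor3_tlift_pure[OF module_A module_V module_A module_VAA descent_map3_trilinear]
        lift_g_pure[OF module_VAA trilinear_bilinear[OF trilinear_rotate[OF pure_VAA_trilinear]]]]) fact+

private definition "unit_side v = tlift K V A VAA (\<lambda>v0 v1. pure_tensor3 K V A A v0 \<one>\<^bsub>A\<^esub> v1) (\<rho> v)"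
private definition "coaction_side v = tlift K V A VAA
  (\<lambda>v0 v1. tlift K V A VAA (\<lambda>w0 w1. pure_tensor3 K V A A w0 w1 v1) (\<rho> v0)) (\<rho> v)"
private definition "twist a b = tensor_map K V (tensor_module K A A) V (tensor_module K A A) (lact V a)
  (tensor_map K A A A A (\<lambda>y. b \<otimes>\<^bsub>A\<^esub> y) (\<lambda>y. y))"

lemma left_mult_first_linear:
  "b \<in> carrier A \<Longrightarrow> is_linear K (tensor_module K A A) (tensor_module K A A)
    (tensor_map K A A A A (\<lambda>y. b \<otimes>\<^bsub>A\<^esub> y) (\<lambda>y. y))"
  by (rule tensor_map_linear[OF module_A module_A module_A module_A left_mult_linear linear_ident])

lemma twist_linear: "\<lbrakk>a \<in> carrier A; b \<in> carrier A\<rbrakk> \<Longrightarrow> is_linear K VAA VAA (twist a b)"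
  unfolding twist_def
  by (rule tensor_map_linear[OF module_V tensor_module_module[OF module_A module_A] module_V tensor_module_module[OF module_A module_A]
        lact_linear left_mult_first_linear])

lemma twist_pure:
  assumes "a \<in> carrier A" "b \<in> carrier A" "v \<in> carrier V" "x \<in> carrier A" "y \<in> carrier A"
  shows "twist a b (pure_tensor3 K V A A v x y) = pure_tensor3 K V A A (lact V a v) (b \<otimes>\<^bsub>A\<^esub> x) y"
  unfolding twist_def pure_tensor3_def using assms
  by (simp add: tensor_map_pure[OF module_V tensor_module_module[OF module_A module_A] module_V tensor_module_module[OF module_A module_A]
        lact_linear left_mult_first_linear] tensor_map_pure[OF module_A module_A module_A module_A left_mult_linear linear_ident] pure_tensor_closed[OF module_A module_A])

lemma twist_one:
  assumes z: "z \<in> carrier VAA"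
  shows "twist \<one>\<^bsub>A\<^esub> \<one>\<^bsub>A\<^esub> z = z"
  by (rule linear_tensor3_eqI[OF module_V module_A module_A module_VAA twist_linear[OF one_closed one_closed] linear_ident])
    (use z in \<open>simp_all add: twist_pure one_lact tensor3_group_def\<close>)

text \<open>The inner lift is bilinear in \<open>v1\<close> and the tensor being decomposed; flip
  these two and substitute \<open>\<rho> v0\<close> for the tensor.\<close>

lemma coaction_side_bilinear:
  "is_bilinear K V A VAA (\<lambda>v0 v1. tlift K V A VAA (\<lambda>w0 w1. pure_tensor3 K V A A w0 w1 v1) (\<rho> v0))"
  by (rule bilinear_comp[OF bilinear_flip[OF tlift_trilinear[OF module_V module_A module_VAA module_A trilinear_rotate[OF pure_VAA_trilinear]]]
        \<rho> linear_ident])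

lemmas unit_side_bilinear = trilinear_bilinear[OF trilinear_swap[OF pure_VAA_trilinear] one_closed]

text \<open>Here \<open>g\<^sub>2\<close> yields \<open>a v0 \<otimes> b \<otimes> v1\<close>;
  reading the middle factor as \<open>b1\<close> exhibits it as the twist of
  \<open>v0 \<otimes> 1 \<otimes> v1\<close>.\<close>

lemma descent_map2_twist:
  assumes c: "a \<in> carrier A" "b \<in> carrier A" "v \<in> carrier V"
  shows "m2 (pure_tensor3 K A A V a b v) = twist a b (unit_side v)"
proof -
  have "twist a b (unit_side v) = tlift K V A VAA (\<lambda>v0 v1. twist a b (pure_tensor3 K V A A v0 \<one>\<^bsub>A\<^esub> v1)) (\<rho> v)"
    unfolding unit_side_def
    by (rule linear_tlift[OF module_V module_A module_VAA module_VAA twist_linear _ coaction_closed])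
      (use c trilinear_bilinear[OF trilinear_swap[OF pure_VAA_trilinear]] in simp_all)
  also have "\<dots> = m2 (pure_tensor3 K A A V a b v)"
    unfolding descent_map2_pure[OF c]
    by (rule fun_cong[OF tensor_lift_cong]) (use c in \<open>simp add: twist_pure\<close>)
  finally show ?thesis ..
qed

text \<open>After \<open>g\<^sub>1\<close> the tensor is
  \<open>a \<otimes> b v0 \<otimes> v1\<close>, and \<open>g\<^sub>3\<close> then requires
  \<open>\<rho> (b v0)\<close>. By \<open>left\<close>, \<open>b\<close> passes to the second leg of
  \<open>\<rho> v0\<close>, which is where the twist puts it.\<close>

lemma descent_map3_descent_map1_twist:
  assumes c: "a \<in> carrier A" "b \<in> carrier A" "v \<in> carrier V"
  shows "m3 (m1 (pure_tensor3 K A A V a b v)) = twist a b (coaction_side v)"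
proof -
  \<comment> \<open>The contribution of one term \<open>w \<otimes> x\<close> of
    \<open>\<rho> v\<close>; the twist is extracted from it before summing over the terms.\<close>
  have inner: "m3 (pure_tensor3 K A V A a (lact V b w) x)
      = twist a b (tlift K V A VAA (\<lambda>w0 w1. pure_tensor3 K V A A w0 w1 x) (\<rho> w))"
    if w: "w \<in> carrier V" and x: "x \<in> carrier A" for w x
  proof -
    have px: "is_bilinear K V A VAA (\<lambda>w0 w1. pure_tensor3 K V A A w0 w1 x)"
      by (rule trilinear_bilinear[OF trilinear_rotate[OF pure_VAA_trilinear] x])
    have "m3 (pure_tensor3 K A V A a (lact V b w) x)
        = tlift K V A VAA (\<lambda>w0 w1. pure_tensor3 K V A A (lact V a w0) w1 x)
            (act (\<lambda>x. x) (\<lambda>y. b \<otimes>\<^bsub>A\<^esub> y) (\<rho> w))"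
      using c w x by (simp add: descent_map3_pure lact_closed left)
    also have "\<dots> = tlift K V A VAA (\<lambda>w0 w1. pure_tensor3 K V A A (lact V a w0) (b \<otimes>\<^bsub>A\<^esub> w1) x) (\<rho> w)"
      by (rule tlift_tensor_map[OF module_V module_A module_V module_A linear_ident left_mult_linear module_VAA
            bilinear_comp[OF px lact_linear linear_ident] coaction_closed]) (use c w in simp_all)
    also have "\<dots> = tlift K V A VAA (\<lambda>w0 w1. twist a b (pure_tensor3 K V A A w0 w1 x)) (\<rho> w)"
      by (rule fun_cong[OF tensor_lift_cong]) (use c x in \<open>simp add: twist_pure\<close>)
    also have "\<dots> = twist a b (tlift K V A VAA (\<lambda>w0 w1. pure_tensor3 K V A A w0 w1 x) (\<rho> w))"
      by (rule linear_tlift[OF module_V module_A module_VAA module_VAA twist_linear px coaction_closed, symmetric]) (use c w in simp_all)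
    finally show ?thesis .
  qed
  have "m3 (m1 (pure_tensor3 K A A V a b v))
      = tlift K V A VAA (\<lambda>w x. m3 (pure_tensor3 K A V A a (lact V b w) x)) (\<rho> v)"
    unfolding descent_map1_pure[OF c]
    by (rule linear_tlift[OF module_V module_A module_AVA module_VAA descent_map3_linear bilinear_comp[OF trilinear_bilinear[OF pure_AVA_trilinear]
            lact_linear linear_ident] coaction_closed]) (use c in simp_all)
  also have "\<dots> = tlift K V A VAA (\<lambda>w x. twist a b (tlift K V A VAA (\<lambda>w0 w1. pure_tensor3 K V A A w0 w1 x) (\<rho> w))) (\<rho> v)"
    by (rule fun_cong[OF tensor_lift_cong]) (rule inner)
  also have "\<dots> = twist a b (coaction_side v)"
    unfolding coaction_side_def
    by (rule linear_tlift[OF module_V module_A module_VAA module_VAA twist_linear coaction_side_bilinear coaction_closed, symmetric]) (use c in simp_all)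
  finally show ?thesis .
qed

lemma cocycle_iff:
  "(\<forall>t\<in>carrier (tensor3_group K A A V). m2 t = m3 (m1 t)) \<longleftrightarrow>
   (\<forall>v\<in>carrier V.
       tlift K V A VAA (\<lambda>v0 v1. tlift K V A VAA (\<lambda>w0 w1. pure_tensor3 K V A A w0 w1 v1) (\<rho> v0)) (\<rho> v)
     = tlift K V A VAA (\<lambda>v0 v1. pure_tensor3 K V A A v0 \<one>\<^bsub>A\<^esub> v1) (\<rho> v))"
    (is "?L \<longleftrightarrow> ?R")
proof
  assume L: ?L
  show ?R
  proof
    fix v assume v: "v \<in> carrier V"
    then have z: "\<rho> v \<in> carrier VA" using coaction_closed by simp
    have "pure_tensor3 K A A V \<one>\<^bsub>A\<^esub> \<one>\<^bsub>A\<^esub> v \<in> carrier (tensor3_group K A A V)"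
      using v by (simp add: pure_tensor3_def tensor3_group_def pure_tensor_closed module_A module_V module_AV)
    then have "twist \<one>\<^bsub>A\<^esub> \<one>\<^bsub>A\<^esub> (coaction_side v) = twist \<one>\<^bsub>A\<^esub> \<one>\<^bsub>A\<^esub> (unit_side v)"
      using L descent_map2_twist[OF one_closed one_closed v] descent_map3_descent_map1_twist[OF one_closed one_closed v] by simp
    moreover have "coaction_side v \<in> carrier VAA" "unit_side v \<in> carrier VAA"
      unfolding coaction_side_def unit_side_def
      using linear_closed[OF tlift_linear[OF module_V module_A module_VAA coaction_side_bilinear] z]
        linear_closed[OF tlift_linear[OF module_V module_A module_VAA unit_side_bilinear] z] .
    ultimately show "tlift K V A VAA (\<lambda>v0 v1. tlift K V A VAA (\<lambda>w0 w1. pure_tensor3 K V A A w0 w1 v1) (\<rho> v0)) (\<rho> v)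
     = tlift K V A VAA (\<lambda>v0 v1. pure_tensor3 K V A A v0 \<one>\<^bsub>A\<^esub> v1) (\<rho> v)"
      using twist_one[of "coaction_side v"] twist_one[of "unit_side v"] by (simp only: coaction_side_def unit_side_def)
  qed
next
  assume ?R
  then have sides: "coaction_side v = unit_side v" if "v \<in> carrier V" for v
    using that by (simp add: coaction_side_def unit_side_def)
  show ?L
  proof
    fix t assume "t \<in> carrier (tensor3_group K A A V)"
    then show "m2 t = m3 (m1 t)"
      by (rule linear_tensor3_eqI[OF module_A module_A module_V module_VAA descent_map2_linear linear_comp[OF descent_map3_linear descent_map1_linear], rotated])
        (simp add: descent_map2_twist descent_map3_descent_map1_twist sides)
  qed
qed

end

end

section \<open>Passing between coactions and descent data\<close>

context bimodule_over
begin

lemmas regular = regular_bimodule_bimodule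
lemmas left_lact_pure = tensor_lact_pure_pure[OF regular bimodule_axioms, simplified]
lemmas left_ract_pure = tensor_ract_pure_pure[OF regular bimodule_axioms, simplified]
lemmas right_lact_pure = tensor_lact_pure[OF bimodule_axioms regular, simplified]
lemmas right_ract_pure = tensor_ract_pure[OF bimodule_axioms regular, simplified]

lemma linear_maps_iff:
  "\<rho> \<in> linear_maps K V VA \<longleftrightarrow> is_linear K V VA \<rho> \<and> \<rho> \<in> extensional (carrier V)"
  by (auto simp: linear_maps_def is_linear_def PiE_iff)

lemma descent_of_yetter_drinfeld:
  assumes yd: "is_yetter_drinfeld K A V \<rho>"
  shows "is_descent_datum K A V (descent_of K A V \<rho>)"
    and "coaction_of K A V (descent_of K A V \<rho>) = \<rho>"
proof -
  let ?g = "descent_of K A V \<rho>"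
  let ?L = "tensor_bimodule K A A (regular_bimodule A) V"
  let ?R = "tensor_bimodule K A A V (regular_bimodule A)"
  have \<rho>: "is_linear K V VA \<rho>" and ext: "\<rho> \<in> extensional (carrier V)"
    and counit: "\<And>v. v \<in> carrier V \<Longrightarrow> tlift K V A V (ract V) (\<rho> v) = v"
    and right: "\<And>v a. \<lbrakk>v \<in> carrier V; a \<in> carrier A\<rbrakk>
       \<Longrightarrow> \<rho> (ract V v a) = act (\<lambda>x. x) (\<lambda>y. y \<otimes>\<^bsub>A\<^esub> a) (\<rho> v)"
    and left: "\<And>a v. \<lbrakk>a \<in> carrier A; v \<in> carrier V\<rbrakk>
       \<Longrightarrow> \<rho> (lact V a v) = act (\<lambda>x. x) (\<lambda>y. a \<otimes>\<^bsub>A\<^esub> y) (\<rho> v)"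
    and mid: "\<And>v a. \<lbrakk>v \<in> carrier V; a \<in> carrier A\<rbrakk>
       \<Longrightarrow> act (lact V a) (\<lambda>y. y) (\<rho> v) = act (\<lambda>x. ract V x a) (\<lambda>y. y) (\<rho> v)"
    using yd by (simp_all add: is_yetter_drinfeld_iff linear_maps_iff)
  note g = descent_of_linear[OF \<rho>]
  note g_pure = descent_of_pure[OF \<rho>]
  note rc = coaction_closed[OF \<rho> left]
  have g_closed: "?g z \<in> carrier (tensor_group K V A)" if "z \<in> carrier (tensor_group K A V)" for z
    using linear_closed[OF g] that by simp
  have g_one: "?g (pure_tensor K A V \<one>\<^bsub>A\<^esub> v) = \<rho> v" if "v \<in> carrier V" for v
    using that by (simp add: g_pure lact_one_tensor rc)
  show "coaction_of K A V ?g = \<rho>"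
    by (rule extensionalityI[OF _ ext]) (simp_all add: coaction_of_def g_one)
  have bl: "is_bilinear K (tensor_module K A A) AV AV (lact ?L)"
    and br: "is_bilinear K AV (tensor_module K A A) AV (ract ?L)"
    and bl': "is_bilinear K (tensor_module K A A) VA VA (lact ?R)"
    and br': "is_bilinear K VA (tensor_module K A A) VA (ract ?R)"
    using tensor_lact_bilinear[OF regular bimodule_axioms] tensor_ract_bilinear[OF regular bimodule_axioms]
      tensor_lact_bilinear[OF bimodule_axioms regular] tensor_ract_bilinear[OF bimodule_axioms regular]
    by simp_all
  have pAA: "pure_tensor K A A a b \<in> carrier (tensor_module K A A)" if "a \<in> carrier A" "b \<in> carrier A" for a b
    using that by (simp add: pure_tensor_closed[OF module_A module_A])
  \<comment> \<open>Both sides are linear in \<open>t\<close> and in \<open>z\<close>. On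
    \<open>a \<otimes> b\<close> and \<open>x \<otimes> v\<close> both equal
    \<open>(ax) v0 \<otimes> b v1\<close>.\<close>
  have lact_g: "?g (lact ?L t z) = lact ?R t (?g z)"
    if t: "t \<in> carrier (tensor_group K A A)" and z: "z \<in> carrier (tensor_group K A V)" for t z
  proof (rule linear_tensor_eqI[OF module_A module_A module_VA _ _ _ t])
    show "is_linear K (tensor_module K A A) VA (\<lambda>t. ?g (lact ?L t z))"
      by (rule linear_comp[OF g bilinear_left[OF bl]]) (use z in simp)
    show "is_linear K (tensor_module K A A) VA (\<lambda>t. lact ?R t (?g z))"
      by (rule bilinear_left[OF bl']) (use z g_closed in simp)
    fix a b assume a: "a \<in> carrier A" and b: "b \<in> carrier A"
    show "?g (lact ?L (pure_tensor K A A a b) z) = lact ?R (pure_tensor K A A a b) (?g z)"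
    proof (rule linear_tensor_eqI[OF module_A module_V module_VA _ _ _ z])
      show "is_linear K AV VA (\<lambda>z. ?g (lact ?L (pure_tensor K A A a b) z))"
        by (rule linear_comp[OF g bilinear_right[OF bl pAA[OF a b]]])
      show "is_linear K AV VA (\<lambda>z. lact ?R (pure_tensor K A A a b) (?g z))"
        by (rule linear_comp[OF bilinear_right[OF bl' pAA[OF a b]] g])
      fix x v assume x: "x \<in> carrier A" and v: "v \<in> carrier V"
      have "?g (lact ?L (pure_tensor K A A a b) (pure_tensor K A V x v))
          = act (lact V (a \<otimes>\<^bsub>A\<^esub> x)) (\<lambda>y. y) (act (\<lambda>x. x) (\<lambda>y. b \<otimes>\<^bsub>A\<^esub> y) (\<rho> v))"
        using a b x v by (simp add: left_lact_pure g_pure lact_closed left)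
      also have "\<dots> = act (lact V (a \<otimes>\<^bsub>A\<^esub> x)) (\<lambda>y. b \<otimes>\<^bsub>A\<^esub> y) (\<rho> v)"
        using a b x v by (simp add: act_comp linear_ident left_mult_linear lact_linear rc)
      also have "\<dots> = act (\<lambda>w. lact V a (lact V x w)) (\<lambda>y. b \<otimes>\<^bsub>A\<^esub> y) (\<rho> v)"
        by (rule fun_cong[OF tensor_map_cong]) (use a x in \<open>simp_all add: mult_lact\<close>)
      also have "\<dots> = act (lact V a) (\<lambda>y. b \<otimes>\<^bsub>A\<^esub> y) (act (lact V x) (\<lambda>y. y) (\<rho> v))"
        using a b x v by (simp add: act_comp linear_ident left_mult_linear lact_linear rc)
      also have "\<dots> = lact ?R (pure_tensor K A A a b) (?g (pure_tensor K A V x v))"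
        using a b x v by (simp add: right_lact_pure g_closed pure_tensor_closed[OF module_A module_V] flip: g_pure)
      finally show "?g (lact ?L (pure_tensor K A A a b) (pure_tensor K A V x v))
          = lact ?R (pure_tensor K A A a b) (?g (pure_tensor K A V x v))" .
    qed
  qed
  \<comment> \<open>The formula for \<open>?g\<close> produces
    \<open>(xa) v0 \<otimes> v1 b\<close>, while the right action on the target asks for
    \<open>(x v0) a \<otimes> v1 b\<close>.\<close>
  have ract_g: "?g (ract ?L z t) = ract ?R (?g z) t"
    if t: "t \<in> carrier (tensor_group K A A)" and z: "z \<in> carrier (tensor_group K A V)" for t z
  proof (rule linear_tensor_eqI[OF module_A module_A module_VA _ _ _ t])
    show "is_linear K (tensor_module K A A) VA (\<lambda>t. ?g (ract ?L z t))"
      by (rule linear_comp[OF g bilinear_right[OF br]]) (use z in simp)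
    show "is_linear K (tensor_module K A A) VA (\<lambda>t. ract ?R (?g z) t)"
      by (rule bilinear_right[OF br']) (use z g_closed in simp)
    fix a b assume a: "a \<in> carrier A" and b: "b \<in> carrier A"
    show "?g (ract ?L z (pure_tensor K A A a b)) = ract ?R (?g z) (pure_tensor K A A a b)"
    proof (rule linear_tensor_eqI[OF module_A module_V module_VA _ _ _ z])
      show "is_linear K AV VA (\<lambda>z. ?g (ract ?L z (pure_tensor K A A a b)))"
        by (rule linear_comp[OF g bilinear_left[OF br pAA[OF a b]]])
      show "is_linear K AV VA (\<lambda>z. ract ?R (?g z) (pure_tensor K A A a b))"
        by (rule linear_comp[OF bilinear_left[OF br' pAA[OF a b]] g])
      fix x v assume x: "x \<in> carrier A" and v: "v \<in> carrier V"
      have lr: "is_linear K V V (\<lambda>w. ract V w a)" by (rule ract_linear[OF a])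
      have "?g (ract ?L (pure_tensor K A V x v) (pure_tensor K A A a b))
          = act (lact V (x \<otimes>\<^bsub>A\<^esub> a)) (\<lambda>y. y) (act (\<lambda>x. x) (\<lambda>y. y \<otimes>\<^bsub>A\<^esub> b) (\<rho> v))"
        using a b x v by (simp add: left_ract_pure g_pure ract_closed right)
      also have "\<dots> = act (lact V (x \<otimes>\<^bsub>A\<^esub> a)) (\<lambda>y. y \<otimes>\<^bsub>A\<^esub> b) (\<rho> v)"
        using a b x v by (simp add: act_comp linear_ident right_mult_linear lact_linear rc)
      also have "\<dots> = act (\<lambda>w. lact V x (lact V a w)) (\<lambda>y. y \<otimes>\<^bsub>A\<^esub> b) (\<rho> v)"
        by (rule fun_cong[OF tensor_map_cong]) (use a x in \<open>simp_all add: mult_lact\<close>)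
      also have "\<dots> = act (lact V x) (\<lambda>y. y \<otimes>\<^bsub>A\<^esub> b) (act (lact V a) (\<lambda>y. y) (\<rho> v))"
        using a b x v by (simp add: act_comp linear_ident right_mult_linear lact_linear rc)
      \<comment> \<open>\<open>mid\<close> concerns the whole tensor \<open>\<rho> v\<close> and not
        its individual terms, which is why the action of \<open>a\<close> was first split off as the
        innermost map.\<close>
      also have "\<dots> = act (lact V x) (\<lambda>y. y \<otimes>\<^bsub>A\<^esub> b) (act (\<lambda>w. ract V w a) (\<lambda>y. y) (\<rho> v))"
        using a v by (simp add: mid)
      also have "\<dots> = act (\<lambda>w. lact V x (ract V w a)) (\<lambda>y. y \<otimes>\<^bsub>A\<^esub> b) (\<rho> v)"
        using a b x v by (simp add: act_comp linear_ident right_mult_linear lact_linear lr rc)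
      also have "\<dots> = act (\<lambda>w. ract V (lact V x w) a) (\<lambda>y. y \<otimes>\<^bsub>A\<^esub> b) (\<rho> v)"
        by (rule fun_cong[OF tensor_map_cong]) (use a x in \<open>simp_all add: lact_ract\<close>)
      also have "\<dots> = act (\<lambda>w. ract V w a) (\<lambda>y. y \<otimes>\<^bsub>A\<^esub> b) (act (lact V x) (\<lambda>y. y) (\<rho> v))"
        using a b x v by (simp add: act_comp linear_ident right_mult_linear lact_linear lr rc)
      also have "\<dots> = ract ?R (?g (pure_tensor K A V x v)) (pure_tensor K A A a b)"
        using a b x v by (simp add: right_ract_pure g_closed pure_tensor_closed[OF module_A module_V] flip: g_pure)
      finally show "?g (ract ?L (pure_tensor K A V x v) (pure_tensor K A A a b))
          = ract ?R (?g (pure_tensor K A V x v)) (pure_tensor K A A a b)" .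
    qed
  qed
  have "?g \<in> bimodule_maps (tensor_module K A A) ?L ?R"
    using descent_of_extensional[OF \<rho>] lact_g ract_g g_closed linear_add[OF g]
    by (simp add: bimodule_maps_def PiE_iff)
  moreover have "\<forall>t\<in>carrier (tensor3_group K A A V).
       descent_map2 K A V ?g t = descent_map3 K A V ?g (descent_map1 K A V ?g t)"
    using yd cocycle_iff[OF \<rho> left] by (simp add: is_yetter_drinfeld_iff)
  moreover have "right_mult_map K A V (?g (pure_tensor K A V \<one>\<^bsub>A\<^esub> v)) = v" if "v \<in> carrier V" for v
    using that by (simp add: right_mult_map_def g_one counit)
  ultimately show "is_descent_datum K A V ?g"
    by (simp add: is_descent_datum_def)
qed

text \<open>The compatibilities with multiplication come from the four ways of multiplying
  \<open>1 \<otimes> v\<close> by \<open>a \<otimes> 1\<close> or \<open>1 \<otimes> a\<close>, on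
  the left or on the right.\<close>

lemma coaction_of_descent_datum:
  assumes d: "is_descent_datum K A V g"
  shows "is_yetter_drinfeld K A V (coaction_of K A V g)"
    and "descent_of K A V (coaction_of K A V g) = g"
proof -
  let ?\<rho> = "coaction_of K A V g"
  let ?L = "tensor_bimodule K A A (regular_bimodule A) V"
  let ?R = "tensor_bimodule K A A V (regular_bimodule A)"
  have bm: "g \<in> bimodule_maps (tensor_module K A A) ?L ?R"
    and unit: "\<And>v. v \<in> carrier V \<Longrightarrow> right_mult_map K A V (g (pure_tensor K A V \<one>\<^bsub>A\<^esub> v)) = v"
    using d by (simp_all add: is_descent_datum_def)
  have ext: "g \<in> extensional (carrier (tensor_group K A V))"
    and g_closed: "\<And>z. z \<in> carrier (tensor_group K A V) \<Longrightarrow> g z \<in> carrier (tensor_group K V A)"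
    and g_add: "\<And>z z'. \<lbrakk>z \<in> carrier (tensor_group K A V); z' \<in> carrier (tensor_group K A V)\<rbrakk>
        \<Longrightarrow> g (z \<otimes>\<^bsub>tensor_group K A V\<^esub> z') = g z \<otimes>\<^bsub>tensor_group K V A\<^esub> g z'"
    and g_lact: "\<And>t z. \<lbrakk>t \<in> carrier (tensor_group K A A); z \<in> carrier (tensor_group K A V)\<rbrakk>
        \<Longrightarrow> g (lact ?L t z) = lact ?R t (g z)"
    and g_ract: "\<And>t z. \<lbrakk>t \<in> carrier (tensor_group K A A); z \<in> carrier (tensor_group K A V)\<rbrakk>
        \<Longrightarrow> g (ract ?L z t) = ract ?R (g z) t"
    using bm by (auto simp: bimodule_maps_def PiE_iff)
  have pAA: "pure_tensor K A A a b \<in> carrier (tensor_group K A A)" if "a \<in> carrier A" "b \<in> carrier A" for a b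
    using that by (simp add: pure_tensor_closed[OF module_A module_A])
  have pAV: "pure_tensor K A V a v \<in> carrier (tensor_group K A V)" if "a \<in> carrier A" "v \<in> carrier V" for a v
    using that by (simp add: pure_tensor_closed[OF module_A module_V])
  \<comment> \<open>Homogeneity is equivariance under \<open>c1 \<otimes> 1\<close>, which acts as
    the scalar \<open>c\<close> on both sides.\<close>
  have g: "is_linear K AV VA g"
  proof (rule is_linearI)
    fix c z assume c: "c \<in> carrier K" and z: "z \<in> carrier AV"
    then show "g (c \<odot>\<^bsub>AV\<^esub> z) = c \<odot>\<^bsub>VA\<^esub> g z"
      using g_lact[OF pAA, of "c \<odot>\<^bsub>A\<^esub> \<one>\<^bsub>A\<^esub>" "\<one>\<^bsub>A\<^esub>" z]
        tensor_lact_central[OF regular bimodule_axioms c, of z]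
        tensor_lact_central[OF bimodule_axioms regular c, of "g z"] g_closed[of z]
      by simp
  qed (simp_all add: g_closed g_add)
  have \<rho>_app: "?\<rho> v = g (pure_tensor K A V \<one>\<^bsub>A\<^esub> v)" if "v \<in> carrier V" for v
    using that by (simp add: coaction_of_def)
  have \<rho>: "is_linear K V VA ?\<rho>"
    by (subst linear_cong[OF module_V \<rho>_app])
      (auto intro: linear_comp[OF g bilinear_right[OF pure_tensor_bilinear[OF module_A module_V]]])
  have rc: "?\<rho> v \<in> carrier (tensor_group K V A)" if "v \<in> carrier V" for v
    using linear_closed[OF \<rho>] that by simp
  have g_pure: "g (pure_tensor K A V a v) = act (lact V a) (\<lambda>y. y) (?\<rho> v)"
    if a: "a \<in> carrier A" and v: "v \<in> carrier V" for a v
  proof -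
    have "g (pure_tensor K A V a v) = g (lact ?L (pure_tensor K A A a \<one>\<^bsub>A\<^esub>) (pure_tensor K A V \<one>\<^bsub>A\<^esub> v))"
      using a v by (simp add: left_lact_pure one_lact)
    also have "\<dots> = act (lact V a) (\<lambda>y. \<one>\<^bsub>A\<^esub> \<otimes>\<^bsub>A\<^esub> y) (?\<rho> v)"
      using a v by (simp add: g_lact pAA pAV right_lact_pure g_closed \<rho>_app)
    also have "\<dots> = act (lact V a) (\<lambda>y. y) (?\<rho> v)"
      by (rule fun_cong[OF tensor_map_cong]) simp_all
    finally show ?thesis .
  qed
  \<comment> \<open>Now \<open>a \<otimes> v\<close> is seen as a right multiple of
    \<open>1 \<otimes> v\<close>; equating this with \<open>g_pure\<close> is the last
    Yetter-Drinfeld condition.\<close>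
  have g_pure': "g (pure_tensor K A V a v) = act (\<lambda>x. ract V x a) (\<lambda>y. y) (?\<rho> v)"
    if a: "a \<in> carrier A" and v: "v \<in> carrier V" for a v
  proof -
    have "g (pure_tensor K A V a v) = g (ract ?L (pure_tensor K A V \<one>\<^bsub>A\<^esub> v) (pure_tensor K A A a \<one>\<^bsub>A\<^esub>))"
      using a v by (simp add: left_ract_pure one_ract)
    also have "\<dots> = act (\<lambda>x. ract V x a) (\<lambda>y. y \<otimes>\<^bsub>A\<^esub> \<one>\<^bsub>A\<^esub>) (?\<rho> v)"
      using a v by (simp add: g_ract pAA pAV right_ract_pure g_closed \<rho>_app)
    also have "\<dots> = act (\<lambda>x. ract V x a) (\<lambda>y. y) (?\<rho> v)"
      by (rule fun_cong[OF tensor_map_cong]) simp_all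
    finally show ?thesis .
  qed
  have left: "?\<rho> (lact V a v) = act (\<lambda>x. x) (\<lambda>y. a \<otimes>\<^bsub>A\<^esub> y) (?\<rho> v)"
    if a: "a \<in> carrier A" and v: "v \<in> carrier V" for a v
  proof -
    have "?\<rho> (lact V a v) = g (lact ?L (pure_tensor K A A \<one>\<^bsub>A\<^esub> a) (pure_tensor K A V \<one>\<^bsub>A\<^esub> v))"
      using a v by (simp add: left_lact_pure \<rho>_app lact_closed)
    also have "\<dots> = act (lact V \<one>\<^bsub>A\<^esub>) (\<lambda>y. a \<otimes>\<^bsub>A\<^esub> y) (?\<rho> v)"
      using a v by (simp add: g_lact pAA pAV right_lact_pure g_closed \<rho>_app)
    also have "\<dots> = act (\<lambda>x. x) (\<lambda>y. a \<otimes>\<^bsub>A\<^esub> y) (?\<rho> v)"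
      by (rule fun_cong[OF tensor_map_cong]) (simp_all add: one_lact)
    finally show ?thesis .
  qed
  have right: "?\<rho> (ract V v a) = act (\<lambda>x. x) (\<lambda>y. y \<otimes>\<^bsub>A\<^esub> a) (?\<rho> v)"
    if a: "a \<in> carrier A" and v: "v \<in> carrier V" for a v
  proof -
    have "?\<rho> (ract V v a) = g (ract ?L (pure_tensor K A V \<one>\<^bsub>A\<^esub> v) (pure_tensor K A A \<one>\<^bsub>A\<^esub> a))"
      using a v by (simp add: left_ract_pure \<rho>_app ract_closed)
    also have "\<dots> = act (\<lambda>x. ract V x \<one>\<^bsub>A\<^esub>) (\<lambda>y. y \<otimes>\<^bsub>A\<^esub> a) (?\<rho> v)"
      using a v by (simp add: g_ract pAA pAV right_ract_pure g_closed \<rho>_app)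
    also have "\<dots> = act (\<lambda>x. x) (\<lambda>y. y \<otimes>\<^bsub>A\<^esub> a) (?\<rho> v)"
      by (rule fun_cong[OF tensor_map_cong]) (simp_all add: one_ract)
    finally show ?thesis .
  qed
  show dg: "descent_of K A V ?\<rho> = g"
  proof (rule extensionalityI[OF descent_of_extensional[OF \<rho>] ext])
    fix z assume "z \<in> carrier (tensor_group K A V)"
    then show "descent_of K A V ?\<rho> z = g z"
      by (rule linear_tensor_eqI[OF module_A module_V module_VA descent_of_linear[OF \<rho>] g, rotated])
        (simp add: descent_of_pure[OF \<rho>] g_pure)
  qed
  \<comment> \<open>\<open>cocycle_iff\<close> speaks of the descent map built from a coaction; by
    \<open>dg\<close> this is \<open>g\<close>, so the cocycle condition on \<open>g\<close> can be
    fed into it.\<close>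
  have cocycle: "\<forall>v\<in>carrier V.
       tlift K V A VAA (\<lambda>v0 v1. tlift K V A VAA (\<lambda>w0 w1. pure_tensor3 K V A A w0 w1 v1) (?\<rho> v0)) (?\<rho> v)
     = tlift K V A VAA (\<lambda>v0 v1. pure_tensor3 K V A A v0 \<one>\<^bsub>A\<^esub> v1) (?\<rho> v)"
    by (rule iffD1[OF cocycle_iff[OF \<rho> left]]) (use d in \<open>simp_all add: dg is_descent_datum_def\<close>)
  have "\<forall>v\<in>carrier V. tlift K V A V (ract V) (?\<rho> v) = v"
    using unit by (simp add: right_mult_map_def \<rho>_app)
  moreover have "\<forall>v\<in>carrier V. \<forall>a\<in>carrier A.
       act (lact V a) (\<lambda>y. y) (?\<rho> v) = act (\<lambda>x. ract V x a) (\<lambda>y. y) (?\<rho> v)"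
    by (simp flip: g_pure g_pure')
  moreover have "?\<rho> \<in> linear_maps K V VA"
    using \<rho> by (simp add: linear_maps_iff coaction_of_def)
  ultimately show "is_yetter_drinfeld K A V ?\<rho>"
    unfolding is_yetter_drinfeld_iff using cocycle left right by blast
qed

end

text \<open>Homogeneity is not part of \<open>bimodule_maps\<close>; it follows from equivariance,
  since scalars act through \<open>c1\<close> in both bimodules.\<close>

lemma bimodule_map_linear:
  assumes V: "bimodule K A V" and W: "bimodule K A W" and f: "f \<in> bimodule_maps A V W"
  shows "is_linear K V W f"
proof -
  interpret V: bimodule K A V by fact
  interpret W: bimodule K A W by fact
  show ?thesis
  proof (rule is_linearI)
    fix c x assume "c \<in> carrier K" "x \<in> carrier V"
    moreover from this have "f (lact V (c \<odot>\<^bsub>A\<^esub> \<one>\<^bsub>A\<^esub>) x) = lact W (c \<odot>\<^bsub>A\<^esub> \<one>\<^bsub>A\<^esub>) (f x)"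
      using f by (simp add: bimodule_maps_def)
    moreover have "f x \<in> carrier W"
      using f \<open>x \<in> carrier V\<close> by (auto simp: bimodule_maps_def)
    ultimately show "f (c \<odot>\<^bsub>V\<^esub> x) = c \<odot>\<^bsub>W\<^esub> f x"
      by (simp add: V.lact_central W.lact_central)
  qed (use f in \<open>auto simp: bimodule_maps_def\<close>)
qed

lemma bimodule_map_restrict_id:
  assumes "bimodule K A V"
  shows "restrict id (carrier V) \<in> bimodule_maps A V V"
proof -
  interpret bimodule K A V by fact
  show ?thesis by (simp add: bimodule_maps_def lact_closed ract_closed)
qed

lemma bimodule_map_compose:
  assumes "bimodule K A V" and f: "f \<in> bimodule_maps A V W" and h: "h \<in> bimodule_maps A W X"
  shows "compose (carrier V) h f \<in> bimodule_maps A V X"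
proof -
  interpret bimodule K A V by fact
  have "f x \<in> carrier W" if "x \<in> carrier V" for x
    using f that by (auto simp: bimodule_maps_def)
  then show ?thesis
    using f h by (auto simp: bimodule_maps_def compose_def lact_closed ract_closed)
qed

section \<open>The isomorphism of categories\<close>

context
  fixes K :: "('k, 'r) ring_scheme" and A :: "('k, 'a, 's) module_scheme"
    and V :: "('k, 'a, 'v) bimod" and W :: "('k, 'a, 'v) bimod" and f
  assumes V: "bimodule K A V" and W: "bimodule K A W" and f: "f \<in> bimodule_maps A V W"
begin

interpretation V: bimodule_over K A V using V by (rule bimodule_over.intro)
interpretation W: bimodule_over K A W using W by (rule bimodule_over.intro)

text \<open>As \<open>f\<close> commutes with the left action, the two sides of the descent
  condition on \<open>a \<otimes> v\<close> arise from the two sides of the coaction condition at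
  \<open>v\<close> by letting \<open>a\<close> act on the first leg. Taking \<open>a = 1\<close>
  gives one implication, reduction to pure tensors the other.\<close>

lemma descent_map_iff_coaction_map:
  assumes \<rho>: "is_linear K V (tensor_module K V A) \<rho>" and \<rho>': "is_linear K W (tensor_module K W A) \<rho>'"
  shows "(\<forall>t\<in>carrier (tensor_group K A V).
        tensor_map K V A W A f id (descent_of K A V \<rho> t) = descent_of K A W \<rho>' (tensor_map K A V A W id f t)) \<longleftrightarrow>
      (\<forall>v\<in>carrier V. \<rho>' (f v) = tensor_map K V A W A f id (\<rho> v))"
    (is "?L \<longleftrightarrow> ?R")
proof -
  have fl: "is_linear K V W f" by (rule bimodule_map_linear[OF V W f])
  have fc: "f v \<in> carrier W" if "v \<in> carrier V" for v using linear_closed[OF fl that] .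
  have f_lact: "f (lact V a v) = lact W a (f v)" if "a \<in> carrier A" "v \<in> carrier V" for a v
    using f that by (simp add: bimodule_maps_def)
  note module_A = V.module_A and module_V = V.module_V and module_W = W.module_V
  have \<rho>c: "\<rho> v \<in> carrier (tensor_group K V A)" if "v \<in> carrier V" for v
    using linear_closed[OF \<rho>] that by simp
  have \<rho>'c: "\<rho>' v \<in> carrier (tensor_group K W A)" if "v \<in> carrier W" for v
    using linear_closed[OF \<rho>'] that by simp
  note map_fl = tensor_map_linear[OF module_V module_A module_W module_A fl linear_ident]
  note map_fr = tensor_map_linear[OF module_A module_V module_A module_W linear_ident fl]
  have lhs: "tensor_map K V A W A f (\<lambda>y. y) (descent_of K A V \<rho> (pure_tensor K A V a v))
      = tensor_map K W A W A (lact W a) (\<lambda>y. y) (tensor_map K V A W A f (\<lambda>y. y) (\<rho> v))"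
    if a: "a \<in> carrier A" and v: "v \<in> carrier V" for a v
  proof -
    have "tensor_map K V A W A f (\<lambda>y. y) (descent_of K A V \<rho> (pure_tensor K A V a v))
        = tensor_map K V A W A (\<lambda>x. f (lact V a x)) (\<lambda>y. y) (\<rho> v)"
      using a v by (simp add: V.descent_of_pure[OF \<rho>] \<rho>c V.lact_linear fl linear_ident
          tensor_map_comp[OF module_V module_A module_V module_A module_W module_A])
    also have "\<dots> = tensor_map K V A W A (\<lambda>x. lact W a (f x)) (\<lambda>y. y) (\<rho> v)"
      by (rule fun_cong[OF tensor_map_cong]) (simp_all add: f_lact a)
    also have "\<dots> = tensor_map K W A W A (lact W a) (\<lambda>y. y) (tensor_map K V A W A f (\<lambda>y. y) (\<rho> v))"
      using a v by (simp add: \<rho>c W.lact_linear fl linear_ident tensor_map_comp[OF module_V module_A module_W module_A module_W module_A])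
    finally show ?thesis .
  qed
  have rhs: "descent_of K A W \<rho>' (tensor_map K A V A W (\<lambda>x. x) f (pure_tensor K A V a v))
      = tensor_map K W A W A (lact W a) (\<lambda>y. y) (\<rho>' (f v))"
    if "a \<in> carrier A" "v \<in> carrier V" for a v
    using that by (simp add: tensor_map_pure[OF module_A module_V module_A module_W linear_ident fl] W.descent_of_pure[OF \<rho>'] fc)
  show ?thesis
    unfolding id_def
  proof (intro iffI ballI)
    fix v assume L: "\<forall>t\<in>carrier (tensor_group K A V).
        tensor_map K V A W A f (\<lambda>y. y) (descent_of K A V \<rho> t)
          = descent_of K A W \<rho>' (tensor_map K A V A W (\<lambda>x. x) f t)"
      and v: "v \<in> carrier V"
    have "tensor_map K W A W A (lact W \<one>\<^bsub>A\<^esub>) (\<lambda>y. y) (tensor_map K V A W A f (\<lambda>y. y) (\<rho> v))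
        = tensor_map K W A W A (lact W \<one>\<^bsub>A\<^esub>) (\<lambda>y. y) (\<rho>' (f v))"
      using L pure_tensor_closed[OF module_A module_V V.one_closed v]
      by (simp add: v flip: lhs rhs)
    moreover have "tensor_map K V A W A f (\<lambda>y. y) (\<rho> v) \<in> carrier (tensor_group K W A)"
      using linear_closed[OF map_fl] \<rho>c v by simp
    ultimately show "\<rho>' (f v) = tensor_map K V A W A f (\<lambda>y. y) (\<rho> v)"
      using v by (simp add: W.lact_one_tensor \<rho>'c fc)
  next
    fix t assume "\<forall>v\<in>carrier V. \<rho>' (f v) = tensor_map K V A W A f (\<lambda>y. y) (\<rho> v)"
      and t: "t \<in> carrier (tensor_group K A V)"
    then show "tensor_map K V A W A f (\<lambda>y. y) (descent_of K A V \<rho> t)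
        = descent_of K A W \<rho>' (tensor_map K A V A W (\<lambda>x. x) f t)"
      by (intro linear_tensor_eqI[OF module_A module_V W.module_VA linear_comp[OF map_fl V.descent_of_linear[OF \<rho>]]
            linear_comp[OF W.descent_of_linear[OF \<rho>'] map_fr] _ t]) (simp add: lhs rhs)
  qed
qed

end

lemma Desc_sel:
  "Obj (Desc K A) = {(V, g). bimodule K A V \<and> normalized K A V \<and> is_descent_datum K A V g}"
  "Hom (Desc K A) (V, g) (V', g') = {f \<in> bimodule_maps A V V'. \<forall>t\<in>carrier (tensor_group K A V).
     tensor_map K V A V' A f id (g t) = g' (tensor_map K A V A V' id f t)}"
  "Id (Desc K A) (V, g) = restrict id (carrier V)"
  "Comp (Desc K A) (V, g) Y Z = compose (carrier V)"
  by (simp_all add: Desc_def)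

lemma YD_sel:
  "Obj (YD K A) = {(V, \<rho>). bimodule K A V \<and> normalized K A V \<and> is_yetter_drinfeld K A V \<rho>}"
  "Hom (YD K A) (V, \<rho>) (V', \<rho>') = {f \<in> bimodule_maps A V V'.
     \<forall>v\<in>carrier V. \<rho>' (f v) = tensor_map K V A V' A f id (\<rho> v)}"
  "Id (YD K A) (V, \<rho>) = restrict id (carrier V)"
  "Comp (YD K A) (V, \<rho>) Y Z = compose (carrier V)"
  by (simp_all add: YD_def)

lemma yetter_drinfeld_linear:
  "is_yetter_drinfeld K A V \<rho> \<Longrightarrow> is_linear K V (tensor_module K V A) \<rho>"
  by (auto simp: is_yetter_drinfeld_def linear_maps_def is_linear_def)

lemma bimodule_maps_sel:
  assumes "f \<in> bimodule_maps A V W"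
  shows "f \<in> carrier V \<rightarrow> carrier W" "f \<in> extensional (carrier V)"
  using assms by (auto simp: bimodule_maps_def PiE_def)

lemma compose_restrict_id: "f \<in> extensional S \<Longrightarrow> compose S f (restrict id S) = f"
  by (rule extensionalityI[of _ S]) (simp_all add: compose_def)

lemma restrict_id_compose:
  "\<lbrakk>f \<in> S \<rightarrow> T; f \<in> extensional S\<rbrakk> \<Longrightarrow> compose S (restrict id T) f = f"
  by (rule extensionalityI[of _ S]) (auto simp: compose_def Pi_iff)

text \<open>The axioms are verified on this side, where the condition on a morphism involves only
  \<open>\<rho> v\<close> and composition reduces to functoriality of \<open>tensor_map\<close>;
  \<open>Desc\<close> then inherits them.\<close>

lemma is_category_YD:
  fixes K :: "('k, 'r) ring_scheme" and A :: "('k, 'a, 's) module_scheme"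
  shows "is_category (YD K A :: (('k, 'a, 'v) yd_object, 'v \<Rightarrow> 'v) category)"
  unfolding is_category_def
proof (intro conjI ballI)
  fix X assume "X \<in> Obj (YD K A :: (('k, 'a, 'v) yd_object, 'v \<Rightarrow> 'v) category)"
  then obtain V \<rho> where X: "X = (V, \<rho>)" and V: "bimodule K A V" and yd: "is_yetter_drinfeld K A V \<rho>"
    by (auto simp: YD_sel)
  interpret V: bimodule_over K A V using V by (rule bimodule_over.intro)
  have "tensor_map K V A V A (restrict id (carrier V)) id (\<rho> v) = \<rho> v" if "v \<in> carrier V" for v
    by (rule trans[OF fun_cong[OF tensor_map_cong] tensor_map_ident[OF V.module_V V.module_A]])
      (use linear_closed[OF yetter_drinfeld_linear[OF yd]] that in simp_all)
  then show "Id (YD K A) X \<in> Hom (YD K A) X X"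
    by (simp add: X YD_sel bimodule_map_restrict_id[OF V])
next
  fix X Y Z f h
  assume XYZ: "X \<in> Obj (YD K A :: (('k, 'a, 'v) yd_object, 'v \<Rightarrow> 'v) category)" "Y \<in> Obj (YD K A)" "Z \<in> Obj (YD K A)"
    and fh: "f \<in> Hom (YD K A) X Y" "h \<in> Hom (YD K A) Y Z"
  obtain V1 \<rho>1 V2 \<rho>2 V3 \<rho>3 where X: "X = (V1, \<rho>1)" "Y = (V2, \<rho>2)" "Z = (V3, \<rho>3)"
    by (metis surj_pair)
  have V: "bimodule K A V1" "bimodule K A V2" "bimodule K A V3" and yd: "is_yetter_drinfeld K A V1 \<rho>1"
    using XYZ by (auto simp: X YD_sel)
  have f: "f \<in> bimodule_maps A V1 V2" and f\<rho>: "\<And>v. v \<in> carrier V1 \<Longrightarrow> \<rho>2 (f v) = tensor_map K V1 A V2 A f id (\<rho>1 v)"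
    and h: "h \<in> bimodule_maps A V2 V3" and h\<rho>: "\<And>v. v \<in> carrier V2 \<Longrightarrow> \<rho>3 (h v) = tensor_map K V2 A V3 A h id (\<rho>2 v)"
    using fh by (auto simp: X YD_sel)
  interpret V1: bimodule K A V1 by fact
  interpret V2: bimodule K A V2 by fact
  interpret V3: bimodule K A V3 by fact
  have "\<rho>3 (compose (carrier V1) h f v) = tensor_map K V1 A V3 A (compose (carrier V1) h f) id (\<rho>1 v)"
    if v: "v \<in> carrier V1" for v
  proof -
    have z: "\<rho>1 v \<in> carrier (tensor_group K V1 A)"
      using linear_closed[OF yetter_drinfeld_linear[OF yd] v] by simp
    have "f v \<in> carrier V2" using bimodule_maps_sel(1)[OF f] v by auto
    then have "\<rho>3 (compose (carrier V1) h f v) = tensor_map K V2 A V3 A h (\<lambda>y. y) (tensor_map K V1 A V2 A f (\<lambda>y. y) (\<rho>1 v))"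
      using v by (simp add: compose_def h\<rho> f\<rho> id_def)
    also have "\<dots> = tensor_map K V1 A V3 A (\<lambda>x. h (f x)) (\<lambda>y. y) (\<rho>1 v)"
      by (rule tensor_map_comp[OF V1.module_V V1.module_A V2.module_V V1.module_A V3.module_V V1.module_A
            bimodule_map_linear[OF V(1,2) f] linear_ident bimodule_map_linear[OF V(2,3) h] linear_ident z])
    also have "\<dots> = tensor_map K V1 A V3 A (compose (carrier V1) h f) id (\<rho>1 v)"
      by (rule fun_cong[OF tensor_map_cong]) (simp_all add: compose_def)
    finally show ?thesis .
  qed
  then show "Comp (YD K A) X Y Z h f \<in> Hom (YD K A) X Z"
    using bimodule_map_compose[OF V(1) f h] by (simp add: X YD_sel)
next
  fix X Y f
  assume "X \<in> Obj (YD K A :: (('k, 'a, 'v) yd_object, 'v \<Rightarrow> 'v) category)" "Y \<in> Obj (YD K A)" "f \<in> Hom (YD K A) X Y"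
  then show "Comp (YD K A) X X Y f (Id (YD K A) X) = f" "Comp (YD K A) X Y Y (Id (YD K A) Y) f = f"
    using bimodule_maps_sel[of f A "fst X" "fst Y"]
    by (auto simp: YD_sel split_paired_all intro: compose_restrict_id restrict_id_compose)
next
  fix W X Y Z :: "('k, 'a, 'v) yd_object" and f g h :: "'v \<Rightarrow> 'v"
  assume "f \<in> Hom (YD K A) W X"
  then have "f \<in> carrier (fst W) \<rightarrow> carrier (fst X)"
    by (cases W, cases X) (auto simp: YD_sel dest: bimodule_maps_sel)
  then show "Comp (YD K A) W X Z (Comp (YD K A) X Y Z h g) f = Comp (YD K A) W Y Z h (Comp (YD K A) W X Y g f)"
    by (cases W, cases X) (simp add: YD_sel compose_assoc)
qed

text \<open>Covers functors that are the identity on maps: when hom-sets, identities and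
  compositions coincide along a bijection of objects, the axioms of \<open>C\<close> are instances
  of those of \<open>D\<close>.\<close>

lemma isomorphic_categoriesI:
  assumes D: "is_category D"
    and F: "\<And>X. X \<in> Obj C \<Longrightarrow> F X \<in> Obj D \<and> G (F X) = X"
    and G: "\<And>X. X \<in> Obj D \<Longrightarrow> G X \<in> Obj C \<and> F (G X) = X"
    and hom: "\<And>X Y. \<lbrakk>X \<in> Obj C; Y \<in> Obj C\<rbrakk> \<Longrightarrow> Hom C X Y = Hom D (F X) (F Y)"
    and id: "\<And>X. X \<in> Obj C \<Longrightarrow> Id C X = Id D (F X)"
    and comp: "\<And>X Y Z. \<lbrakk>X \<in> Obj C; Y \<in> Obj C; Z \<in> Obj C\<rbrakk>
      \<Longrightarrow> Comp C X Y Z = Comp D (F X) (F Y) (F Z)"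
  shows "is_category C" and "isomorphic_categories C D"
proof -
  show "is_category C"
    using D F unfolding is_category_def by (simp add: hom id comp)
  have "is_functor C D F (\<lambda>X Y f. f)"
    using F by (simp add: is_functor_def hom id comp)
  moreover have "is_functor D C G (\<lambda>X Y f. f)"
    using G by (simp add: is_functor_def hom id comp)
  ultimately show "isomorphic_categories C D"
    unfolding isomorphic_categories_def using F G
    by (intro exI[of _ F] exI[of _ "\<lambda>X Y f. f"] exI[of _ G]) simp
qed

theorem proposition2p8:
  fixes K :: "('k, 'r) ring_scheme" and A :: "('k, 'a, 's) module_scheme"
  assumes "cring K" and "assoc_algebra K A"
  shows "is_category (Desc K A :: (('k, 'a, 'v) desc_object, 'v \<Rightarrow> 'v) category)
    \<and> is_category (YD K A :: (('k, 'a, 'v) yd_object, 'v \<Rightarrow> 'v) category)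
    \<and> isomorphic_categories
        (Desc K A :: (('k, 'a, 'v) desc_object, 'v \<Rightarrow> 'v) category)
        (YD K A :: (('k, 'a, 'v) yd_object, 'v \<Rightarrow> 'v) category)"
proof -
  let ?C = "Desc K A :: (('k, 'a, 'v) desc_object, 'v \<Rightarrow> 'v) category"
  let ?D = "YD K A :: (('k, 'a, 'v) yd_object, 'v \<Rightarrow> 'v) category"
  let ?F = "\<lambda>(V, g). (V, coaction_of K A V g)" and ?G = "\<lambda>(V, \<rho>). (V, descent_of K A V \<rho>)"
  \<comment> \<open>The bimodule is unchanged, so \<open>normalized\<close> carries over. The round
    trip is an equality of functions, not just agreement on carriers, because the data on both sides
    are extensional.\<close>
  have F: "?F X \<in> Obj ?D \<and> ?G (?F X) = X" if "X \<in> Obj ?C" for X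
    using that bimodule_over.coaction_of_descent_datum[OF bimodule_over.intro]
    by (auto simp: Desc_sel YD_sel)
  have G: "?G X \<in> Obj ?C \<and> ?F (?G X) = X" if "X \<in> Obj ?D" for X
    using that bimodule_over.descent_of_yetter_drinfeld[OF bimodule_over.intro]
    by (auto simp: Desc_sel YD_sel)
  have hom: "Hom ?C X Y = Hom ?D (?F X) (?F Y)" if X: "X \<in> Obj ?C" and Y: "Y \<in> Obj ?C" for X Y
  proof -
    obtain V g W g' where XY: "X = (V, g)" "Y = (W, g')" by (metis surj_pair)
    have V: "bimodule K A V" and W: "bimodule K A W"
      and "is_descent_datum K A V g" and "is_descent_datum K A W g'"
      using X Y by (auto simp: XY Desc_sel)
    then have g: "is_yetter_drinfeld K A V (coaction_of K A V g)" "descent_of K A V (coaction_of K A V g) = g"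
      and g': "is_yetter_drinfeld K A W (coaction_of K A W g')" "descent_of K A W (coaction_of K A W g') = g'"
      using bimodule_over.coaction_of_descent_datum[OF bimodule_over.intro] by blast+
    \<comment> \<open>Reading \<open>g\<close> and \<open>g'\<close> as descent maps of their own
      coactions brings the two hom-set conditions into the form compared by
      \<open>descent_map_iff_coaction_map\<close>.\<close>
    show ?thesis
      using descent_map_iff_coaction_map[OF V W _ yetter_drinfeld_linear[OF g(1)] yetter_drinfeld_linear[OF g'(1)]]
      by (auto simp: XY Desc_sel YD_sel g(2) g'(2))
  qed
  have id: "Id ?C X = Id ?D (?F X)" for X
    by (cases X) (simp add: Desc_sel YD_sel)
  have comp: "Comp ?C X Y Z = Comp ?D (?F X) (?F Y) (?F Z)" for X Y Z
    by (cases X) (simp add: Desc_sel YD_sel)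
  show ?thesis
    using isomorphic_categoriesI[of ?D ?C ?F ?G, OF is_category_YD F G hom id comp] is_category_YD
    by blast
qed

end
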